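(* Let $|q|<1$ and let $(\alpha_n(a,k),\beta_n(a,k))_{n\ge 0}$ be sequences depending on parameters $a,k$ such that both $(\alpha_n(a,k),\beta_n(a,k))$ and $(\alpha_n(1/a,1/k),\beta_n(1/a,1/k))$ are WP-Bailey pairs (with base $q$). Let $z$ satisfy $|qa|<|z|<|a/q|$, and assume the parameters are such that no denominator below vanishes and all infinite series below converge absolutely. Then \begin{multline*} \sum_{n=1}^{\infty} \frac{(q\sqrt{k},-q\sqrt{k},z;q)_{n}(q;q)_{n-1}}{(\sqrt{k},-\sqrt{k}, q k,q k/z;q)_{n}}\left( \frac{q a}{ z }\right )^{n} \beta_n(a,k) - \sum_{n=1}^{\infty}\frac{(q/\sqrt{k},-q/\sqrt{k},1/z;q)_{n}(q;q)_{n-1}}{(1/\sqrt{k},-1/\sqrt{k}, q/k,q z/k;q)_{n}}\left( \frac{q z}{ a }\right )^{n}\beta_n(1/a,1/k)\\ - \sum_{n=1}^{\infty}\frac{(z;q)_{n}(q;q)_{n-1}}{(q a ,q a/z;q)_n}\left (\frac{q a}{z}\right)^{n}\alpha_n(a,k) +\sum_{n=1}^{\infty}\frac{(1/z;q)_{n}(q;q)_{n-1}}{(q/a ,q z/a;q)_n}\left (\frac{q z}{a}\right)^{n}\alpha_n(1/a,1/k)\\ =\frac{(a-k)(1-1/z)(1-ak/z)}{(1-a)(1-k)(1-a/z)(1-k/z)} +\frac{z}{k}\,\frac{(z,q/z,k/a,qa/k,ak/z,qz/(ak),q,q;q)_{\infty}}{(z/k,qk/z,z/a,qa/z,a,q/a,k,q/k;q)_{\infty}}.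 \end{multline*}
   Context: Notation: $(x;q)_n=(1-x)(1-xq)\cdots(1-xq^{n-1})$, $(x;q)_0=1$, $(x;q)_\infty=\prod_{j\ge0}(1-xq^j)$, and $(x_1,\dots,x_m;q)_n=(x_1;q)_n\cdots(x_m;q)_n$ (also for $n=\infty$). A WP-Bailey pair (with parameters $a,k$ and base $q$) is a pair of sequences $(\alpha_n(a,k,q),\beta_n(a,k,q))_{n\ge0}$ with $\alpha_0=\beta_0=1$ and, for $n>0$, $$\beta_n(a,k,q)=\sum_{j=0}^{n}\frac{(k/a;q)_{n-j}(k;q)_{n+j}}{(q;q)_{n-j}(aq;q)_{n+j}}\alpha_j(a,k,q).$$ *)

theory Defs
  imports "HOL-Analysis.Analysis"
begin

definition qpoch :: "complex \<Rightarrow> complex \<Rightarrow> nat \<Rightarrow> complex" where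
  "qpoch x q n = (\<Prod>j<n. (1 - x * q ^ j))"

definition qpinf :: "complex \<Rightarrow> complex \<Rightarrow> complex" where
  "qpinf x q = prodinf (\<lambda>j. 1 - x * q ^ j)"

definition wp_bailey_pair ::
  "complex \<Rightarrow> complex \<Rightarrow> complex \<Rightarrow> (nat \<Rightarrow> complex) \<Rightarrow> (nat \<Rightarrow> complex) \<Rightarrow> bool" where
  "wp_bailey_pair a k q \<alpha> \<beta> \<longleftrightarrow>
     \<alpha> 0 = 1 \<and> \<beta> 0 = 1 \<and>
     (\<forall>n>0. \<beta> n = (\<Sum>j\<le>n. qpoch (k / a) q (n - j) * qpoch k q (n + j)
                       / (qpoch q q (n - j) * qpoch (a * q) q (n + j)) * \<alpha> j))"

end

theory Submission
  imports Defs "HOL-Complex_Analysis.Complex_Analysis"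
begin

text \<open>
  Inserting the definition of \<open>\<beta>\<^sub>n\<close> and exchanging the order of summation, the coefficient of
  \<open>\<alpha>\<^sub>j\<close> for \<open>j > 0\<close> is a nonterminating very-well-poised \<open>6\<phi>5\<close> series, which Rogers' sum evaluates
  to the coefficient in the \<open>\<alpha>\<close>-series. For \<open>j = 0\<close> one meets the derivative of the same sum at
  \<open>d = 1\<close>, a combination of Lambert series \<open>L(x) = \<Sum>\<^sub>n\<^sub>\<ge>\<^sub>1 x q\<^sup>n / (1 - x q\<^sup>n)\<close>. Hence
  the difference of the \<open>\<beta>\<close>- and the \<open>\<alpha>\<close>-series is \<open>L(k) + L(a/z) - L(a) - L(k/z)\<close>, and
  subtracting the same identity with \<open>a, k, z\<close> inverted leaves the logarithmic derivatives of the theta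
  function \<open>\<theta>(x) = (x, q/x; q)\<^sub>\<infinity>\<close> at \<open>k, a/z, a, k/z\<close>. Their combination is the infinite
  product by the classical four-term identity for the Weierstrass zeta function, a consequence of
  Liouville's theorem.
\<close>

section \<open>Infinite q-Pochhammer symbols\<close>

text \<open>With n = j + m the factor (q;q)_{n-1} equals (q;q)_{j-1} (q^j;q)_m, which is how q^j
  becomes the numerator parameter d of the inner series. At j = 0 it is 1, and (q;q)_{n-1} is what
  remains of (d;q)_n after division by 1 - d. No differentiation in d is carried out: the
  certificate that proves Rogers' sum also telescopes the series at d = 1, where the multiplier of
  the recurrence is 1 and one boundary term survives. These boundary terms, added up along a, a q, a
  q^2, ..., are the Lambert series. Rogers' sum itself comes from the recurrence under a -> a q,
  because the series at a q^N tends to 1; neither a terminating case nor analytic continuation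
  enters. The difference L(x) - L(1/x) lacks the exponent 0 term x/(1-x) of the logarithmic
  derivative of theta; the four missing terms make up the rational function in the result. The
  annulus condition on z places the arguments a q/z and q z/a of the two families of series in the
  unit disc.\<close>

lemma qpoch_0 [simp]: "qpoch x q 0 = 1"
  by (simp add: qpoch_def)

lemma qpoch_Suc: "qpoch x q (Suc n) = qpoch x q n * (1 - x * q ^ n)"
  by (simp add: qpoch_def)

lemma qpoch_add: "qpoch x q (m + n) = qpoch x q m * qpoch (x * q ^ m) q n"
  by (induction n) (simp_all add: qpoch_Suc power_add algebra_simps)

lemma qpoch_Suc_left: "qpoch x q (Suc n) = (1 - x) * qpoch (x * q) q n"
  using qpoch_add[of x q 1 n] by (simp add: qpoch_Suc)

lemma qpoch_eq_0_iff: "qpoch x q n = 0 \<longleftrightarrow> (\<exists>j<n. x * q ^ j = 1)"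
proof -
  have "1 - x * q ^ j = 0 \<longleftrightarrow> x * q ^ j = 1" for j
    by (metis right_minus_eq)
  thus ?thesis by (simp add: qpoch_def Bex_def)
qed

lemma convergent_prod_qpinf:
  fixes q x :: complex
  assumes "norm q < 1"
  shows "convergent_prod (\<lambda>j. 1 - x * q ^ j)"
proof -
  have "summable (\<lambda>j. norm (- x * q ^ j))"
    unfolding norm_mult norm_power using assms by (intro summable_mult summable_geometric) simp
  moreover have "(1 - x * q ^ j) - 1 = - x * q ^ j" for j by simp
  ultimately have "summable (\<lambda>j. norm ((1 - x * q ^ j) - 1))"
    by (simp only:)
  thus ?thesis
    by (intro abs_convergent_prod_imp_convergent_prod summable_imp_abs_convergent_prod)
qed

lemma qpoch_tendsto_qpinf:
  assumes "norm q < 1"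
  shows "qpoch x q \<longlonglongrightarrow> qpinf x q"
proof -
  have "(\<lambda>n. \<Prod>j\<le>n. 1 - x * q ^ j) \<longlonglongrightarrow> qpinf x q"
    unfolding qpinf_def by (rule convergent_prod_LIMSEQ[OF convergent_prod_qpinf[OF assms]])
  thus ?thesis
    unfolding LIMSEQ_lessThan_iff_atMost[symmetric] qpoch_def .
qed

lemma qpinf_eq_0_iff:
  assumes "norm q < 1"
  shows "qpinf x q = 0 \<longleftrightarrow> (\<exists>j. x * q ^ j = 1)"
proof -
  have "(\<lambda>j. 1 - x * q ^ j) has_prod qpinf x q"
    unfolding qpinf_def using convergent_prod_qpinf[OF assms] by blast
  from has_prod_eq_0_iff[OF this] have "qpinf x q = 0 \<longleftrightarrow> (\<exists>j. 1 - x * q ^ j = 0)"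
    by (auto simp: image_iff simp del: right_minus_eq)
  also have "\<dots> \<longleftrightarrow> (\<exists>j. x * q ^ j = 1)"
    by (metis right_minus_eq)
  finally show ?thesis .
qed

lemma qpinf_split:
  assumes "norm q < 1"
  shows "qpinf x q = qpoch x q n * qpinf (x * q ^ n) q"
proof -
  have "(\<lambda>m. qpoch x q (m + n)) \<longlonglongrightarrow> qpinf x q"
    using qpoch_tendsto_qpinf[OF assms] by (rule LIMSEQ_ignore_initial_segment)
  moreover have "(\<lambda>m. qpoch x q (m + n)) \<longlonglongrightarrow> qpoch x q n * qpinf (x * q ^ n) q"
    unfolding add.commute[of _ n] qpoch_add
    by (intro tendsto_mult_left qpoch_tendsto_qpinf assms)
  ultimately show ?thesis by (rule LIMSEQ_unique)
qed

lemma qpinf_Suc: "norm q < 1 \<Longrightarrow> qpinf x q = (1 - x) * qpinf (x * q) q"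
  using qpinf_split[of q x 1] by (simp add: qpoch_Suc)

text \<open>Uniformity in the shift \<open>m\<close>, and not only in the length \<open>n\<close>,
  is the point: it later gives one majorant for all series with \<open>a\<close> replaced by
  \<open>a * q ^ N\<close>.\<close>

lemma qpoch_bounded:
  assumes "norm q < 1"
  obtains M where "M > 0" and "\<And>n m. norm (qpoch (x * q ^ m) q n) \<le> M"
proof
  show "exp (norm x / (1 - norm q)) > 0" by simp
  fix n m
  have "norm (qpoch (x * q ^ m) q n) = (\<Prod>j<n. norm (1 - x * q ^ m * q ^ j))"
    unfolding qpoch_def by (simp add: prod_norm)
  also have "\<dots> \<le> (\<Prod>j<n. 1 + norm (x * q ^ j))"
  proof (rule prod_mono, safe)
    fix j
    have "norm (1 - x * q ^ m * q ^ j) \<le> 1 + norm (x * q ^ m * q ^ j)"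
      using norm_triangle_ineq4[of 1 "x * q ^ m * q ^ j"] by simp
    also have "norm (x * q ^ m * q ^ j) = norm q ^ m * norm (x * q ^ j)"
      by (simp add: norm_mult norm_power)
    also have "\<dots> \<le> 1 * norm (x * q ^ j)"
      using assms by (intro mult_right_mono power_le_one) auto
    finally show "norm (1 - x * q ^ m * q ^ j) \<le> 1 + norm (x * q ^ j)" by simp
  qed simp
  also have "\<dots> \<le> exp (\<Sum>j<n. norm (x * q ^ j))"
    by (rule prod_le_exp_sum) auto
  also have "(\<Sum>j<n. norm (x * q ^ j)) \<le> (\<Sum>j. norm (x * q ^ j))"
    unfolding norm_mult norm_power
    using assms by (intro sum_le_suminf summable_mult summable_geometric) auto
  also have "(\<Sum>j. norm (x * q ^ j)) = norm x / (1 - norm q)"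
    using assms by (simp add: norm_mult norm_power suminf_mult summable_geometric suminf_geometric)
  finally show "norm (qpoch (x * q ^ m) q n) \<le> exp (norm x / (1 - norm q))" by simp
qed

text \<open>A nonvanishing sequence with nonzero limit stays away from 0, which settles
  \<open>m = 0\<close>. A shifted block is the quotient of a product of length \<open>m + n\<close>
  by one of length \<open>m\<close>, so a lower bound is divided by an upper bound.\<close>

lemma qpoch_bounded_below:
  assumes q: "norm q < 1" and nz: "\<And>j. x * q ^ j \<noteq> 1"
  obtains c where "c > 0" and "\<And>n m. norm (qpoch (x * q ^ m) q n) \<ge> c"
proof -
  have "(\<lambda>n. inverse (qpoch x q n)) \<longlonglongrightarrow> inverse (qpinf x q)"
    using nz by (intro tendsto_inverse qpoch_tendsto_qpinf q) (simp add: qpinf_eq_0_iff[OF q])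
  hence "Bseq (\<lambda>n. inverse (qpoch x q n))"
    by (rule convergent_imp_Bseq[OF convergentI])
  then obtain K where K: "K > 0" "\<And>n. norm (inverse (qpoch x q n)) \<le> K"
    by (auto simp: Bseq_def)
  obtain M where M: "M > 0" "\<And>n m. norm (qpoch (x * q ^ m) q n) \<le> M"
    using qpoch_bounded[OF q, of x] by metis
  have ne: "qpoch x q n \<noteq> 0" for n
    using nz by (auto simp: qpoch_eq_0_iff)
  show ?thesis
  proof
    show "inverse K / M > 0" using K M by simp
    fix n m
    have "inverse K \<le> norm (qpoch x q (m + n))"
      using le_imp_inverse_le[OF K(2)[of "m + n"]] ne[of "m + n"] by (simp add: norm_inverse)
    also have "\<dots> = norm (qpoch x q m) * norm (qpoch (x * q ^ m) q n)"
      by (simp add: qpoch_add norm_mult)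
    also have "\<dots> \<le> M * norm (qpoch (x * q ^ m) q n)"
      using M(2)[of 0 m] by (intro mult_right_mono) auto
    finally show "inverse K / M \<le> norm (qpoch (x * q ^ m) q n)"
      using M(1) by (subst pos_divide_le_eq) (simp_all add: mult.commute)
  qed
qed

lemma uniform_limit_qpoch:
  assumes q: "norm q < 1"
  shows "uniform_limit (cball 0 R) (\<lambda>n x. qpoch x q n) (\<lambda>x. qpinf x q) sequentially"
proof -
  have "uniformly_convergent_on (cball 0 R) (\<lambda>n x. \<Prod>j<n. 1 - x * q ^ j)"
  proof (rule uniformly_convergent_on_prod')
    show "uniformly_convergent_on (cball 0 R) (\<lambda>N x. \<Sum>n<N. norm (1 - x * q ^ n - 1))"
    proof (rule Weierstrass_m_test'_ev)
      show "\<forall>\<^sub>F n in sequentially. \<forall>x\<in>cball 0 R. norm (norm (1 - x * q ^ n - 1)) \<le> R * norm q ^ n"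
        by (intro always_eventually) (auto simp: norm_mult norm_power intro!: mult_right_mono)
      show "summable (\<lambda>n. R * norm q ^ n)"
        using q by (intro summable_mult summable_geometric) simp
    qed
  qed (auto intro!: continuous_intros)
  then obtain g where g: "uniform_limit (cball 0 R) (\<lambda>n x. qpoch x q n) g sequentially"
    by (auto simp: uniformly_convergent_on_def qpoch_def)
  have "g x = qpinf x q" if "x \<in> cball 0 R" for x
    using tendsto_uniform_limitI[OF g that] qpoch_tendsto_qpinf[OF q, of x] LIMSEQ_unique by blast
  hence "uniform_limit (cball 0 R) (\<lambda>n x. qpoch x q n) g sequentially \<longleftrightarrow> ?thesis"
    by (intro uniform_limit_cong') auto
  with g show ?thesis by blast
qed

lemma qpinf_holomorphic:
  assumes q: "norm q < 1"
  shows "(\<lambda>x. qpinf x q) holomorphic_on A"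
proof -
  have "(\<lambda>x. qpinf x q) holomorphic_on UNIV"
  proof (rule holomorphic_uniform_sequence)
    fix x :: complex
    have "uniform_limit (cball x 1) (\<lambda>n x. qpoch x q n) (\<lambda>x. qpinf x q) sequentially"
      by (rule uniform_limit_on_subset[OF uniform_limit_qpoch[OF q, of "norm x + 1"]])
         (simp add: cball_subset_cball_iff)
    thus "\<exists>d>0. cball x d \<subseteq> UNIV \<and>
        uniform_limit (cball x d) (\<lambda>n x. qpoch x q n) (\<lambda>x. qpinf x q) sequentially"
      by (intro exI[of _ 1]) auto
  qed (auto intro!: holomorphic_intros simp: qpoch_def)
  thus ?thesis by (rule holomorphic_on_subset) simp
qed

section \<open>Logarithmic derivatives and Lambert series\<close>

lemma qpinf_logderiv_sums:
  assumes q: "norm q < 1" and nz: "qpinf x q \<noteq> 0"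
  shows "(\<lambda>n. x * q ^ n / (1 - x * q ^ n)) sums (- x * deriv (\<lambda>x. qpinf x q) x / qpinf x q)"
proof -
  have d: "deriv (\<lambda>x. 1 - x * q ^ k) x = - (q ^ k)" for k
    by (rule DERIV_imp_deriv) (auto intro!: derivative_eq_intros)
  have "uniform_limit (ball 0 (norm x + 1)) (\<lambda>n x. \<Prod>j<n. 1 - x * q ^ j) (\<lambda>x. qpinf x q) sequentially"
    by (rule uniform_limit_on_subset[OF uniform_limit_qpoch[OF q, of "norm x + 1", unfolded qpoch_def]]) auto
  hence "(\<lambda>k. deriv (\<lambda>x. 1 - x * q ^ k) x / (1 - x * q ^ k)) sums
          (deriv (\<lambda>x. qpinf x q) x / qpinf x q)"
    by (rule logderiv_prodinf_complex_uniform_limit)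
       (use nz norm_ge_zero[of x] in \<open>auto intro!: holomorphic_intros simp del: norm_ge_zero\<close>)
  \<comment> \<open>Applying -x d/dx instead of d/dx makes the Lambert terms appear with a positive
    sign.\<close>
  from sums_mult[OF this, of "- x"] show ?thesis
    unfolding d by simp
qed

lemma power_Suc_neq_1:
  fixes q :: complex
  assumes "norm q < 1"
  shows "q * q ^ j \<noteq> 1"
proof
  assume "q * q ^ j = 1"
  hence "norm q ^ Suc j = 1" by (metis norm_one norm_power power_Suc)
  thus False using assms power_Suc_less_one[of "norm q" j]
    by (cases "q = 0") auto
qed

text \<open>The exponents start at 1 so that \<open>lambert q x\<close> and
  \<open>lambert q (1 / x)\<close> have the same shape; the exponent 0 term is kept apart and feeds
  the rational part of the result.\<close>

definition lambert :: "complex \<Rightarrow> complex \<Rightarrow> complex" where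
  "lambert q x = (\<Sum>n. x * q ^ Suc n / (1 - x * q ^ Suc n))"

lemma lambert_sums:
  assumes q: "norm q < 1" and nz: "\<And>n. x * q * q ^ n \<noteq> 1"
  shows "(\<lambda>n. x * q ^ Suc n / (1 - x * q ^ Suc n)) sums lambert q x"
proof -
  have "qpinf (x * q) q \<noteq> 0" using nz by (simp add: qpinf_eq_0_iff[OF q])
  from sums_summable[OF qpinf_logderiv_sums[OF q this]] show ?thesis
    unfolding lambert_def by (intro summable_sums) (simp add: mult_ac)
qed

section \<open>The theta function\<close>

definition qtheta :: "complex \<Rightarrow> complex \<Rightarrow> complex" where
  "qtheta q x = qpinf x q * qpinf (q / x) q"

context
  fixes q :: complex
  assumes q: "norm q < 1" and q0: "q \<noteq> 0"
begin

text \<open>The half-open annulus is a fundamental domain for x -> q x on the punctured plane: every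
  orbit meets it exactly once. Properties invariant under the shift need checking only
  there.\<close>

lemma fundamental_annulus_induct:
  assumes r: "r > 0" and x: "x \<noteq> 0"
    and shift: "\<And>x. x \<noteq> 0 \<Longrightarrow> P (q * x) \<longleftrightarrow> P x"
    and base: "\<And>x. norm q * r < norm x \<Longrightarrow> norm x \<le> r \<Longrightarrow> P x"
  shows "P x"
proof -
  have shifts: "P (q ^ n * x) \<longleftrightarrow> P x" if "x \<noteq> 0" for n x
  proof (induction n)
    case (Suc n)
    have "P (q ^ Suc n * x) \<longleftrightarrow> P (q ^ n * x)"
      using shift[of "q ^ n * x"] q0 that by (simp add: mult.assoc)
    with Suc show ?case by blast
  qed simp
  show ?thesis
  proof (cases "norm x \<le> r")
    case True
    have "\<exists>n. norm q ^ n < norm x / r"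
      using q x r by (intro real_arch_pow_inv) auto
    then obtain n0 where n0: "norm q ^ n0 * r < norm x"
      using r by (auto simp: field_simps)
    \<comment> \<open>Minimality gives the opposite estimate one exponent lower, so |x| lies between
      two consecutive circles of radius |q|^n r.\<close>
    define n where "n = (LEAST n. norm q ^ Suc n * r < norm x)"
    have "norm q ^ Suc n0 * r \<le> norm q ^ n0 * r"
      using q r by (intro mult_right_mono power_decreasing) auto
    with n0 have "norm q ^ Suc n0 * r < norm x" by linarith
    hence n1: "norm q ^ Suc n * r < norm x"
      unfolding n_def by (rule LeastI[of "\<lambda>n. norm q ^ Suc n * r < norm x"])
    have n2: "norm x \<le> norm q ^ n * r"
    proof (cases n)
      case 0
      thus ?thesis using True by simp
    next
      case (Suc m)
      hence "\<not> norm q ^ Suc m * r < norm x"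
        unfolding n_def by (intro not_less_Least) simp
      thus ?thesis using Suc by simp
    qed
    have qn: "norm q ^ n > 0" using q0 by simp
    have "P (x / q ^ n)"
    proof (rule base)
      show "norm q * r < norm (x / q ^ n)"
        using n1 qn by (simp add: norm_divide norm_power pos_less_divide_eq mult_ac)
      show "norm (x / q ^ n) \<le> r"
        using n2 qn by (simp add: norm_divide norm_power pos_divide_le_eq mult_ac)
    qed
    thus ?thesis using shifts[of "x / q ^ n" n] q0 x by simp
  next
    case False
    have "\<exists>n. norm q ^ n < r / norm x"
      using q x r by (intro real_arch_pow_inv) auto
    then obtain n0 where n0: "norm q ^ n0 * norm x \<le> r"
      using x by (auto simp: field_simps intro: less_imp_le)
    define n where "n = (LEAST n. norm q ^ n * norm x \<le> r)"
    have n1: "norm q ^ n * norm x \<le> r"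
      unfolding n_def using n0 by (rule LeastI[of "\<lambda>n. norm q ^ n * norm x \<le> r"])
    have "n \<noteq> 0" using n1 False by (intro notI) simp
    then obtain m where m: "n = Suc m" by (cases n) auto
    hence "\<not> norm q ^ m * norm x \<le> r"
      unfolding n_def by (intro not_less_Least) simp
    hence n2: "norm q * r < norm q ^ n * norm x"
      using q0 by (simp add: m)
    have "P (q ^ n * x)"
      by (rule base) (use n1 n2 in \<open>simp_all add: norm_mult norm_power\<close>)
    thus ?thesis using shifts[of x n] x by simp
  qed
qed

text \<open>The shift removes the factor 1 - x from the first product and adds 1 - 1/x to the
  second; their quotient is the multiplier -1/x.\<close>

lemma qtheta_shift: "x \<noteq> 0 \<Longrightarrow> qtheta q (q * x) = - qtheta q x / x"
proof -
  assume x: "x \<noteq> 0"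
  have "qtheta q (q * x) = qpinf (x * q) q * ((1 - 1 / x) * qpinf (q / x) q)"
    using qpinf_Suc[OF q, of "1 / x"] q0 by (simp add: qtheta_def mult_ac)
  also have "(1 - 1 / x) = - (1 - x) / x" using x by (simp add: field_simps)
  also have "qpinf (x * q) q * (- (1 - x) / x * qpinf (q / x) q) = - qtheta q x / x"
    unfolding qtheta_def qpinf_Suc[OF q, of x] by (simp add: algebra_simps)
  finally show ?thesis .
qed

lemma qtheta_inverse: "x \<noteq> 0 \<Longrightarrow> qtheta q (1 / x) = - qtheta q x / x"
  using qtheta_shift[of x] q0 by (simp add: qtheta_def mult_ac)

lemma qtheta_1 [simp]: "qtheta q 1 = 0"
  by (simp add: qtheta_def qpinf_Suc[OF q, of 1])

lemma qtheta_holomorphic: "qtheta q holomorphic_on - {0}"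
proof -
  have "((\<lambda>x. qpinf x q) \<circ> (\<lambda>x. q / x)) holomorphic_on - {0}"
    by (rule holomorphic_on_compose_gen[OF _ qpinf_holomorphic[OF q, of UNIV]])
       (auto intro!: holomorphic_intros)
  hence "(\<lambda>x. qpinf x q * qpinf (q / x) q) holomorphic_on - {0}"
    by (intro holomorphic_intros qpinf_holomorphic[OF q]) (simp add: o_def)
  thus ?thesis by (simp add: qtheta_def[abs_def])
qed

lemma qtheta_DERIV: "x \<noteq> 0 \<Longrightarrow> (qtheta q has_field_derivative deriv (qtheta q) x) (at x)"
  by (rule holomorphic_derivI[OF qtheta_holomorphic]) auto

lemmas qtheta_DERIV' [derivative_intros] = DERIV_chain2[OF qtheta_DERIV]

lemma deriv_qtheta_shift:
  assumes x: "x \<noteq> 0"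
  shows "q * deriv (qtheta q) (q * x) = qtheta q x / x ^ 2 - deriv (qtheta q) x / x"
proof -
  have "((\<lambda>x. qtheta q (q * x)) has_field_derivative (q * deriv (qtheta q) (q * x))) (at x)"
    using x q0 by (auto intro!: derivative_eq_intros)
  moreover have "((\<lambda>x. - qtheta q x / x) has_field_derivative
      (qtheta q x / x ^ 2 - deriv (qtheta q) x / x)) (at x)"
    using x by (auto intro!: derivative_eq_intros simp: field_simps power2_eq_square)
  moreover have "eventually (\<lambda>x. x \<in> - {0}) (nhds x)"
    using x by (intro eventually_nhds_in_open) auto
  hence "eventually (\<lambda>x. qtheta q (q * x) = - qtheta q x / x) (nhds x)"
    by eventually_elim (simp add: qtheta_shift)
  hence "((\<lambda>x. qtheta q (q * x)) has_field_derivative (q * deriv (qtheta q) (q * x))) (at x) \<longleftrightarrow>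
      ((\<lambda>x. - qtheta q x / x) has_field_derivative (q * deriv (qtheta q) (q * x))) (at x)"
    by (intro DERIV_cong_ev refl)
  ultimately show ?thesis
    using DERIV_unique by blast
qed

text \<open>Theta is 1 - x times a function that is holomorphic off 0 and equals (q;q)_infinity
  squared at 1. This constant is the source of the two factors (q;q)_infinity in the final
  product.\<close>

lemma deriv_qtheta_1: "deriv (qtheta q) 1 = - (qpinf q q ^ 2)"
proof -
  define F where "F = (\<lambda>x. qpinf (x * q) q * qpinf (q / x) q)"
  have "(\<lambda>x. (1 - x) * F x) = qtheta q"
  proof
    fix x show "(1 - x) * F x = qtheta q x"
      unfolding F_def qtheta_def qpinf_Suc[OF q, of x] by simp
  qed
  have 1: "((\<lambda>x. qpinf x q) \<circ> (\<lambda>x. q / x)) holomorphic_on - {0}"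
    by (rule holomorphic_on_compose_gen[OF _ qpinf_holomorphic[OF q, of UNIV]])
       (auto intro!: holomorphic_intros)
  have 2: "((\<lambda>x. qpinf x q) \<circ> (\<lambda>x. x * q)) holomorphic_on - {0}"
    by (rule holomorphic_on_compose_gen[OF _ qpinf_holomorphic[OF q, of UNIV]])
       (auto intro!: holomorphic_intros)
  have "F holomorphic_on - {0}"
    unfolding F_def using holomorphic_on_mult[OF 2 1] by (simp add: o_def)
  hence "(F has_field_derivative deriv F 1) (at 1)"
    by (rule holomorphic_derivI) auto
  hence "((\<lambda>x. (1 - x) * F x) has_field_derivative - F 1) (at 1)"
    by (auto intro!: derivative_eq_intros)
  thus ?thesis
    unfolding \<open>(\<lambda>x. (1 - x) * F x) = qtheta q\<close>
    by (simp add: DERIV_imp_deriv F_def power2_eq_square)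
qed

text \<open>A zero has the form q^(-j) or q^(j+1) with j >= 0. The bounds on |x| leave only j = 0 in
  the first family and nothing in the second.\<close>

lemma qtheta_zero_in_annulus:
  assumes "norm q < norm x" "norm x \<le> 1" "qtheta q x = 0"
  shows "x = 1"
proof -
  from assms(3) consider j where "x * q ^ j = 1" | j where "q / x * q ^ j = 1"
    by (auto simp: qtheta_def qpinf_eq_0_iff[OF q])
  thus ?thesis
  proof cases
    case 1
    have "j = 0"
    proof (rule ccontr)
      assume "j \<noteq> 0"
      hence "norm (x * q ^ j) \<le> 1 * norm q"
        unfolding norm_mult norm_power using assms(2) q
        by (intro mult_mono) (auto simp: power_le_one power_Suc_le_self 
          intro: order_trans[OF power_decreasing[of 1 j "norm q"]])
      with 1 q show False by simp
    qed
    with 1 show ?thesis by simp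
  next
    case 2
    have "norm (q / x * q ^ j) < 1"
    proof -
      have "norm (q / x) < 1" using assms(1) by (simp add: norm_divide divide_simps)
      moreover have "norm (q ^ j) \<le> 1" using q by (simp add: norm_power power_le_one)
      ultimately show ?thesis unfolding norm_mult
        by (metis mult_right_le_one_le norm_ge_zero order_le_less_trans)
    qed
    with 2 show ?thesis by simp
  qed
qed

text \<open>At a zero the theta term in \<open>deriv_qtheta_shift\<close> drops out, so simplicity
  of zeros is invariant under the shift and is decided at x = 1.\<close>

lemma deriv_qtheta_nonzero:
  assumes "x \<noteq> 0" "qtheta q x = 0"
  shows "deriv (qtheta q) x \<noteq> 0"
proof -
  have qq: "qpinf q q \<noteq> 0"
    using power_Suc_neq_1[OF q] by (simp add: qpinf_eq_0_iff[OF q])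
  have "qtheta q x = 0 \<longrightarrow> deriv (qtheta q) x \<noteq> 0"
  proof (rule fundamental_annulus_induct[of 1 x])
    fix x :: complex assume x: "x \<noteq> 0"
    have "qtheta q (q * x) = 0 \<longleftrightarrow> qtheta q x = 0"
      using x by (simp add: qtheta_shift)
    moreover have "deriv (qtheta q) (q * x) = 0 \<longleftrightarrow> deriv (qtheta q) x = 0" if "qtheta q x = 0"
      using deriv_qtheta_shift[OF x] that q0 x by auto
    ultimately show "(qtheta q (q * x) = 0 \<longrightarrow> deriv (qtheta q) (q * x) \<noteq> 0) \<longleftrightarrow>
        (qtheta q x = 0 \<longrightarrow> deriv (qtheta q) x \<noteq> 0)" by blast
  next
    fix x :: complex assume "norm q * 1 < norm x" "norm x \<le> 1"
    thus "qtheta q x = 0 \<longrightarrow> deriv (qtheta q) x \<noteq> 0"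
      using qtheta_zero_in_annulus[of x] qq by (auto simp: deriv_qtheta_1)
  qed (use assms in auto)
  with assms show ?thesis by blast
qed

text \<open>Equal multipliers make N/D invariant under x -> q x, and the simple zeros of D are
  absorbed by N. The quotient is thus holomorphic on the punctured plane and bounded by its values
  on one compact annulus.\<close>

lemma quasiperiodic_quotient_constant:
  assumes N: "N holomorphic_on - {0}" and D: "D holomorphic_on - {0}"
    and u: "\<And>x. x \<noteq> 0 \<Longrightarrow> u x \<noteq> 0"
    and Nq: "\<And>x. x \<noteq> 0 \<Longrightarrow> N (q * x) = u x * N x"
    and Dq: "\<And>x. x \<noteq> 0 \<Longrightarrow> D (q * x) = u x * D x"
    and simple: "\<And>x. x \<noteq> 0 \<Longrightarrow> D x = 0 \<Longrightarrow> deriv D x \<noteq> 0"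
    and zero: "\<And>x. x \<noteq> 0 \<Longrightarrow> D x = 0 \<Longrightarrow> N x = 0"
  obtains c where "\<And>x. x \<noteq> 0 \<Longrightarrow> N x = c * D x"
proof -
  \<comment> \<open>At a zero of \<open>D\<close> the value is the limit of the quotient, by
    l'Hopital's rule at a simple zero.\<close>
  define g where "g = (\<lambda>x. if D x = 0 then deriv N x / deriv D x else N x / D x)"
  have dN: "(N has_field_derivative deriv N x) (at x)" if "x \<noteq> 0" for x
    by (rule holomorphic_derivI[OF N]) (use that in auto)
  have dD: "(D has_field_derivative deriv D x) (at x)" if "x \<noteq> 0" for x
    by (rule holomorphic_derivI[OF D]) (use that in auto)
  have lim0: "(\<lambda>y. N y / D y) \<midarrow>x\<rightarrow> g x" and ev0: "eventually (\<lambda>y. D y \<noteq> 0) (at x)"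
    if x: "x \<noteq> 0" for x
  proof -
    consider "D x \<noteq> 0" | "D x = 0" by blast
    hence "(\<lambda>y. N y / D y) \<midarrow>x\<rightarrow> g x \<and> eventually (\<lambda>y. D y \<noteq> 0) (at x)"
    proof cases
      case 1
      have DD: "D \<midarrow>x\<rightarrow> D x" using DERIV_isCont[OF dD[OF x]] by (simp add: isCont_def)
      have NN: "N \<midarrow>x\<rightarrow> N x" using DERIV_isCont[OF dN[OF x]] by (simp add: isCont_def)
      show ?thesis
        using tendsto_divide[OF NN DD] tendsto_imp_eventually_ne[OF DD] 1 by (simp add: g_def)
    next
      case 2
      have qN: "(\<lambda>y. N y / (y - x)) \<midarrow>x\<rightarrow> deriv N x"
        using dN[OF x] zero[OF x 2] by (simp add: has_field_derivative_iff)
      have qD: "(\<lambda>y. D y / (y - x)) \<midarrow>x\<rightarrow> deriv D x"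
        using dD[OF x] 2 by (simp add: has_field_derivative_iff)
      have "(\<lambda>y. (N y / (y - x)) / (D y / (y - x))) \<midarrow>x\<rightarrow> deriv N x / deriv D x"
        by (intro tendsto_divide qN qD simple x 2)
      moreover have "eventually (\<lambda>y. (N y / (y - x)) / (D y / (y - x)) = N y / D y) (at x)"
        using eventually_neq_at_within[of x] by eventually_elim simp
      ultimately have "(\<lambda>y. N y / D y) \<midarrow>x\<rightarrow> deriv N x / deriv D x"
        using tendsto_cong by fast
      moreover have "eventually (\<lambda>y. D y / (y - x) \<noteq> 0) (at x)"
        by (rule tendsto_imp_eventually_ne[OF qD]) (rule simple[OF x 2])
      hence "eventually (\<lambda>y. D y \<noteq> 0) (at x)" by eventually_elim auto
      ultimately show ?thesis using 2 by (simp add: g_def)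
    qed
    thus "(\<lambda>y. N y / D y) \<midarrow>x\<rightarrow> g x" "eventually (\<lambda>y. D y \<noteq> 0) (at x)" by auto
  qed
  have g_an: "g analytic_on {x}" if x: "x \<noteq> 0" for x
  proof -
    from ev0[OF x] obtain d where d: "d > 0" "\<And>y. y \<noteq> x \<Longrightarrow> dist y x < d \<Longrightarrow> D y \<noteq> 0"
      unfolding eventually_at by auto
    define A where "A = ball x d - {0}"
    have "(\<lambda>y. N y / D y) holomorphic_on A - {x}"
      using d by (intro holomorphic_on_divide holomorphic_on_subset[OF N] holomorphic_on_subset[OF D])
                 (auto simp: A_def dist_commute)
    moreover have A: "open A" "x \<in> A" using x d(1) by (auto simp: A_def)
    ultimately have "(\<lambda>y. if y = x then g x else N y / D y) holomorphic_on A"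
      using lim0[OF x] by (intro removable_singularity)
    hence "g holomorphic_on A"
      by (rule holomorphic_transform) (use d(2) in \<open>auto simp: A_def g_def dist_commute\<close>)
    with A show ?thesis unfolding analytic_at by blast
  qed
  have g_shift: "g (q * x) = g x" if x: "x \<noteq> 0" for x
  proof -
    have qx: "q * x \<noteq> 0" using x q0 by simp
    have "filterlim (\<lambda>y. q * y) (at (q * x)) (at x)"
      using q0 by (intro filterlim_atI tendsto_intros) (auto simp: eventually_at_filter)
    hence "(\<lambda>y. N (q * y) / D (q * y)) \<midarrow>x\<rightarrow> g (q * x)"
      by (rule filterlim_compose[OF lim0[OF qx]])
    moreover have "eventually (\<lambda>y. y \<in> - {0}) (at x)"
      using x by (intro eventually_at_in_open') auto
    hence "eventually (\<lambda>y. N (q * y) / D (q * y) = N y / D y) (at x)"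
      by eventually_elim (use Nq Dq u in auto)
    ultimately have "(\<lambda>y. N y / D y) \<midarrow>x\<rightarrow> g (q * x)"
      using tendsto_cong by fast
    with lim0[OF x] show ?thesis using tendsto_unique[OF at_neq_bot] by blast
  qed
  have g_hol: "g holomorphic_on - {0}"
    using g_an analytic_on_analytic_at[of g "- {0}"] analytic_imp_holomorphic by blast
  obtain M where M: "\<And>x. x \<noteq> 0 \<Longrightarrow> norm (g x) \<le> M"
  proof -
    define K where "K = cball 0 1 - ball (0 :: complex) (norm q)"
    have "compact K" unfolding K_def by (intro compact_diff) auto
    moreover have "continuous_on K g"
      using q0 by (intro holomorphic_on_imp_continuous_on holomorphic_on_subset[OF g_hol]) (auto simp: K_def)
    ultimately have "bounded (g ` K)"
      by (intro compact_imp_bounded compact_continuous_image)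
    then obtain M where M: "\<And>x. x \<in> K \<Longrightarrow> norm (g x) \<le> M" by (auto simp: bounded_iff)
    have "norm (g x) \<le> M" if "x \<noteq> 0" for x
      by (rule fundamental_annulus_induct[of 1 x]) (use that g_shift M in \<open>auto simp: K_def\<close>)
    thus ?thesis using that by blast
  qed
  \<comment> \<open>Composing with exp replaces the punctured plane by the whole plane, where
    Liouville's theorem applies.\<close>
  have "(g \<circ> exp) holomorphic_on UNIV"
    by (rule holomorphic_on_compose_gen[OF holomorphic_on_exp g_hol]) auto
  hence "(\<lambda>t. g (exp t)) holomorphic_on UNIV"
    by (simp add: o_def)
  moreover have "bounded (range (\<lambda>t. g (exp t)))"
    unfolding bounded_iff using M by (intro exI[of _ M]) auto
  ultimately obtain c where c: "\<And>t. g (exp t) = c"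
    using Liouville_theorem[of "\<lambda>t. g (exp t)"] unfolding constant_on_def by auto
  have "N x = c * D x" if x: "x \<noteq> 0" for x
  proof -
    have "g x = c" using c[of "Ln x"] x by simp
    thus ?thesis using zero[OF x] by (auto simp: g_def split: if_splits)
  qed
  thus ?thesis using that by blast
qed

end

text \<open>
  Up to an additive constant, this is the Weierstrass zeta function in multiplicative notation.
\<close>

definition qzeta :: "complex \<Rightarrow> complex \<Rightarrow> complex" where
  "qzeta q x = - x * deriv (qtheta q) x / qtheta q x"

section \<open>The four-term identity and the Lambert expansion of \<open>qzeta\<close>\<close>

context
  fixes q :: complex
  assumes q: "norm q < 1" and q0: "q \<noteq> 0"
begin

text \<open>The summand 1 is the contribution of the multiplier -1/x of theta under -x d/dx
  log.\<close>

lemma qzeta_shift: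
  assumes x: "x \<noteq> 0" and t: "qtheta q x \<noteq> 0"
  shows "qzeta q (q * x) = qzeta q x + 1"
proof -
  have "qzeta q (q * x) = - x * (q * deriv (qtheta q) (q * x)) / qtheta q (q * x)"
    by (simp add: qzeta_def)
  also have "\<dots> = - x * (qtheta q x / x ^ 2 - deriv (qtheta q) x / x) / (- qtheta q x / x)"
    unfolding deriv_qtheta_shift[OF q q0 x] qtheta_shift[OF q q0 x] ..
  also have "\<dots> = qzeta q x + 1"
    using x t by (simp add: qzeta_def field_simps power2_eq_square)
  finally show ?thesis .
qed

text \<open>A zero z of theta is an integral power of q, so each difference is an integer depending
  on z alone. This is the degenerate case of the four-term identity.\<close>

lemma qzeta_diff_of_qtheta_zero:
  assumes "x \<noteq> 0" "y \<noteq> 0" "z \<noteq> 0" "qtheta q z = 0" "qtheta q (x / z) \<noteq> 0" "qtheta q (y / z) \<noteq> 0"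
  shows "qzeta q (x / z) - qzeta q x = qzeta q (y / z) - qzeta q y"
proof -
  have "qtheta q z = 0 \<longrightarrow> qtheta q (x / z) \<noteq> 0 \<longrightarrow> qtheta q (y / z) \<noteq> 0 \<longrightarrow>
      qzeta q (x / z) - qzeta q x = qzeta q (y / z) - qzeta q y" (is "?P z")
  proof (rule fundamental_annulus_induct[OF q q0, of 1 z])
    fix z :: complex assume z: "z \<noteq> 0"
    have *: "(qtheta q (w / (q * z)) = 0 \<longleftrightarrow> qtheta q (w / z) = 0) \<and>
        (qtheta q (w / z) \<noteq> 0 \<longrightarrow> qzeta q (w / (q * z)) = qzeta q (w / z) - 1)" if w: "w \<noteq> 0" for w
    proof -
      have nz: "w / (q * z) \<noteq> 0" and eq: "w / z = q * (w / (q * z))" using w z q0 by auto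
      have 1: "qtheta q (w / (q * z)) = 0 \<longleftrightarrow> qtheta q (w / z) = 0"
        unfolding eq qtheta_shift[OF q q0 nz] using nz by simp
      moreover have "qzeta q (w / z) = qzeta q (w / (q * z)) + 1" if "qtheta q (w / z) \<noteq> 0"
        using qzeta_shift[OF nz] that unfolding 1[symmetric] eq[symmetric] by simp
      ultimately show ?thesis by auto
    qed
    have "qtheta q (q * z) = 0 \<longleftrightarrow> qtheta q z = 0"
      using qtheta_shift[OF q q0 z] z by simp
    thus "?P (q * z) \<longleftrightarrow> ?P z"
      using *[OF assms(1)] *[OF assms(2)] by auto
  next
    fix z :: complex assume "norm q * 1 < norm z" "norm z \<le> 1"
    thus "?P z" using qtheta_zero_in_annulus[OF q q0, of z] by auto
  qed (use assms in auto)
  with assms show ?thesis by blast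
qed

theorem qzeta_four_term:
  assumes a: "a \<noteq> 0" and k: "k \<noteq> 0" and z: "z \<noteq> 0"
    and ta: "qtheta q a \<noteq> 0" and tk: "qtheta q k \<noteq> 0"
    and taz: "qtheta q (a / z) \<noteq> 0" and tkz: "qtheta q (k / z) \<noteq> 0"
  shows "qzeta q k - qzeta q (k / z) + qzeta q (a / z) - qzeta q a =
    - a / z * deriv (qtheta q) 1 * qtheta q z * qtheta q (k / a) * qtheta q (a * k / z) /
      (qtheta q k * qtheta q (k / z) * qtheta q a * qtheta q (a / z))"
proof (cases "qtheta q z = 0")
  \<comment> \<open>Here z is a power of q, so theta(x) and theta(x/z) have the same zeros and their
    product has double zeros, which the quotient argument excludes. The right-hand side is
    0.\<close>
  case True
  have "qzeta q (a / z) - qzeta q a = qzeta q (k / z) - qzeta q k"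
    using qzeta_diff_of_qtheta_zero[of a k z] a k z taz tkz True by blast
  thus ?thesis using True by (simp add: algebra_simps)
next
  case False
  \<comment> \<open>The left-hand side minus the right-hand side, as a function of \<open>a\<close>, is \<open>N / D\<close>. The value of
    \<open>c\<close> makes \<open>N\<close> vanish at the zeros \<open>1\<close> and \<open>z\<close> of \<open>D\<close>, that of \<open>C\<close> makes it vanish at \<open>k\<close>.\<close>
  define T where "T = qtheta q"
  define T' where "T' = deriv T"
  define c where "c = T z * T' 1 / (T (k / z) * T k)"
  define C where "C = qzeta q k - qzeta q (k / z)"
  define N where "N = (\<lambda>x. C * T x * T (x / z) - x / z * T' (x / z) * T x + x * T' x * T (x / z)
     + c * (x / z) * T (k / x) * T (x * k / z))"
  define D where "D = (\<lambda>x. T x * T (x / z))"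
  have T_hol: "T holomorphic_on - {0}" and T'_hol: "T' holomorphic_on - {0}"
    unfolding T'_def T_def using qtheta_holomorphic[OF q q0] by (auto intro: holomorphic_deriv)
  note comp = holomorphic_on_compose_gen[OF _ T_hol, of _ "- {0}", unfolded o_def]
    holomorphic_on_compose_gen[OF _ T'_hol, of _ "- {0}", unfolded o_def]
  have N_hol: "N holomorphic_on - {0}"
    unfolding N_def by (intro holomorphic_intros comp T_hol T'_hol) (use k z in auto)
  have D_hol: "D holomorphic_on - {0}"
    unfolding D_def by (intro holomorphic_intros comp T_hol) (use z in auto)
  have T_shift: "T (q * x) = - T x / x" if "x \<noteq> 0" for x
    using qtheta_shift[OF q q0 that] by (simp add: T_def)
  have T'_shift: "q * T' (q * x) = T x / x ^ 2 - T' x / x" if "x \<noteq> 0" for x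
    using deriv_qtheta_shift[OF q q0 that] by (simp add: T_def T'_def)
  have T_inv: "T (1 / x) = - T x / x" if "x \<noteq> 0" for x
    using qtheta_inverse[OF q q0 that] by (simp add: T_def)
  have T1: "T 1 = 0" by (simp add: T_def q q0)
  have D_shift: "D (q * x) = z / x ^ 2 * D x" if x: "x \<noteq> 0" for x
    using T_shift[OF x] T_shift[of "x / z"] x z by (simp add: D_def power2_eq_square)
  \<comment> \<open>Each of the two derivative terms produces an extra multiple of
    \<open>T x * T (x / z)\<close>. The extra terms have opposite signs and cancel, so
    \<open>N\<close> has the same multiplier as \<open>D\<close>.\<close>
  have N_shift: "N (q * x) = z / x ^ 2 * N x" if x: "x \<noteq> 0" for x
  proof -
    define y where "y = x / z"
    have y: "y \<noteq> 0" using x z by (simp add: y_def)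
    have y_eqs: "q * x / z = q * y" "q * x * k / z = q * (k * y)" "x / z = y" "x * k / z = k * y"
      using z by (simp_all add: y_def)
    have e1: "T (q * (k * y)) = - T (k * y) / (k * y)"
      by (rule T_shift) (use k y in auto)
    have "T (k / x) = - T (k / (q * x)) / (k / (q * x))"
      using T_shift[of "k / (q * x)"] k x q0 by simp
    hence e2: "T (k / (q * x)) = - (k / (q * x)) * T (k / x)"
      using k x q0 by simp
    have e3: "q * x * T' (q * x) = T x / x - T' x"
    proof -
      have "q * x * T' (q * x) = x * (q * T' (q * x))" by simp
      also have "\<dots> = T x / x - T' x"
        unfolding T'_shift[OF x] using x by (simp add: field_simps power2_eq_square)
      finally show ?thesis .
    qed
    have e4: "q * y * T' (q * y) = T y / y - T' y"
    proof -
      have "q * y * T' (q * y) = y * (q * T' (q * y))" by simp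
      also have "\<dots> = T y / y - T' y"
        unfolding T'_shift[OF y] using y by (simp add: field_simps power2_eq_square)
      finally show ?thesis .
    qed
    have "N (q * x) = C * (- T x / x) * (- T y / y) - (T y / y - T' y) * (- T x / x)
        + (T x / x - T' x) * (- T y / y)
        + c * (q * y) * (- (k / (q * x)) * T (k / x)) * (- T (k * y) / (k * y))"
      unfolding N_def y_eqs e1 e2 e3 e4 T_shift[OF x] T_shift[OF y] ..
    also have "\<dots> = 1 / (x * y) * (C * T x * T y - y * T' y * T x + x * T' x * T y
        + c * y * T (k / x) * T (k * y))"
      using x y k q0 by (simp add: field_simps)
    also have "1 / (x * y) = z / x ^ 2"
      using x z by (simp add: y_def power2_eq_square)
    finally show ?thesis unfolding N_def y_eqs .
  qed
  \<comment> \<open>Since z is not a power of q, the zero orbits of 1 and z are disjoint; hence all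
    zeros of \<open>D\<close> are simple.\<close>
  have T_disj: "T (x / z) \<noteq> 0" if "x \<noteq> 0" "T x = 0" for x
  proof -
    have "T x = 0 \<longrightarrow> T (x / z) \<noteq> 0"
    proof (rule fundamental_annulus_induct[OF q q0, of 1 x])
      fix x :: complex assume x: "x \<noteq> 0"
      show "(T (q * x) = 0 \<longrightarrow> T (q * x / z) \<noteq> 0) \<longleftrightarrow> (T x = 0 \<longrightarrow> T (x / z) \<noteq> 0)"
        using T_shift[OF x] T_shift[of "x / z"] x z by simp
    next
      fix x :: complex assume "norm q * 1 < norm x" "norm x \<le> 1"
      thus "T x = 0 \<longrightarrow> T (x / z) \<noteq> 0"
        using qtheta_zero_in_annulus[OF q q0, of x] T_inv[OF z] False z by (auto simp: T_def)
    qed (use that in auto)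
    with that show ?thesis by blast
  qed
  have D_simple: "deriv D x \<noteq> 0" if x: "x \<noteq> 0" and D0: "D x = 0" for x
  proof -
    have dT: "(T has_field_derivative T' x) (at x)" if "x \<noteq> 0" for x
      unfolding T_def T'_def by (rule qtheta_DERIV[OF q q0 that])
    have xz: "x / z \<noteq> 0" using x z by simp
    have "((\<lambda>x. T (x / z)) has_field_derivative T' (x / z) * (1 / z)) (at x)"
      by (rule DERIV_chain2[of T _ "\<lambda>x. x / z", OF dT[OF xz]]) (use z in \<open>auto intro!: derivative_eq_intros\<close>)
    from DERIV_mult[OF dT[OF x] this]
    have "deriv D x = T' x * T (x / z) + T' (x / z) * (1 / z) * T x"
      unfolding D_def by (intro DERIV_imp_deriv) simp
    moreover have "T' x \<noteq> 0" if "T x = 0"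
      using deriv_qtheta_nonzero[OF q q0 x] that by (simp add: T_def T'_def)
    moreover have "T' (x / z) \<noteq> 0" if "T (x / z) = 0"
      using deriv_qtheta_nonzero[OF q q0 xz] that by (simp add: T_def T'_def)
    ultimately show ?thesis using D0 T_disj[OF x] z by (auto simp: D_def)
  qed
  have TkTkz: "T k \<noteq> 0" "T (k / z) \<noteq> 0" using tk tkz by (simp_all add: T_def)
  have N1: "N 1 = 0"
    using T_inv[OF z] TkTkz z by (simp add: N_def T1 c_def)
  have Nz: "N z = 0"
    using TkTkz z by (simp add: N_def T1 c_def)
  have NT: "T x = 0 \<longrightarrow> N x = 0" if "x \<noteq> 0" for x
  proof (rule fundamental_annulus_induct[OF q q0, of 1 x])
    fix x :: complex assume x: "x \<noteq> 0"
    show "(T (q * x) = 0 \<longrightarrow> N (q * x) = 0) \<longleftrightarrow> (T x = 0 \<longrightarrow> N x = 0)"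
      using T_shift[OF x] N_shift[OF x] x z by simp
  next
    fix x :: complex assume "norm q * 1 < norm x" "norm x \<le> 1"
    thus "T x = 0 \<longrightarrow> N x = 0"
      using qtheta_zero_in_annulus[OF q q0, of x] N1 by (auto simp: T_def)
  qed (use that in auto)
  \<comment> \<open>The annulus of outer radius |z| is chosen because \<open>T (x / z)\<close>
    vanishes there only at x = z.\<close>
  have NTz: "T (x / z) = 0 \<longrightarrow> N x = 0" if "x \<noteq> 0" for x
  proof (rule fundamental_annulus_induct[OF q q0, of "norm z" x])
    fix x :: complex assume x: "x \<noteq> 0"
    show "(T (q * x / z) = 0 \<longrightarrow> N (q * x) = 0) \<longleftrightarrow> (T (x / z) = 0 \<longrightarrow> N x = 0)"
      using T_shift[of "x / z"] N_shift[OF x] x z by simp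
  next
    fix x :: complex assume "norm q * norm z < norm x" "norm x \<le> norm z"
    hence "norm q < norm (x / z)" "norm (x / z) \<le> 1"
      using z by (simp_all add: norm_divide pos_less_divide_eq)
    thus "T (x / z) = 0 \<longrightarrow> N x = 0"
      using qtheta_zero_in_annulus[OF q q0, of "x / z"] Nz z by (auto simp: T_def)
  qed (use that z in auto)
  have zero: "N x = 0" if "x \<noteq> 0" "D x = 0" for x
    using NT[OF that(1)] NTz[OF that(1)] that(2) by (auto simp: D_def)
  have u: "z / x ^ 2 \<noteq> 0" if "x \<noteq> 0" for x using that z by simp
  obtain d where d: "\<And>x. x \<noteq> 0 \<Longrightarrow> N x = d * D x"
    using quasiperiodic_quotient_constant[OF q q0 N_hol D_hol u N_shift D_shift D_simple zero] by blast
  have "N k = 0"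
    using TkTkz k by (simp add: N_def C_def qzeta_def T1 T'_def[symmetric] T_def[symmetric] field_simps)
  with d[OF k] TkTkz have "d = 0" by (simp add: D_def)
  with d[OF a] have "N a = 0" by simp
  hence num: "C * T a * T (a / z) - a / z * T' (a / z) * T a + a * T' a * T (a / z) =
      - (c * (a / z) * T (k / a) * T (a * k / z))"
    unfolding N_def by (rule add_eq_0_iff2[THEN iffD1])
  have "C + qzeta q (a / z) - qzeta q a =
      (C * T a * T (a / z) - a / z * T' (a / z) * T a + a * T' a * T (a / z)) / (T a * T (a / z))"
    using ta taz unfolding qzeta_def T'_def[symmetric] T_def[symmetric] by (simp add: field_simps)
  note this[unfolded num]
  thus ?thesis
    unfolding C_def c_def T_def T'_def by (simp add: mult_ac)
qed

text \<open>The operator -x d/dx log acts with opposite signs on the products in x and in q/x. The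
  first product starts at exponent 0, the second at exponent 1, whence the unpaired term
  x/(1-x).\<close>

lemma qzeta_eq_lambert:
  assumes x: "x \<noteq> 0" and t: "qtheta q x \<noteq> 0"
  shows "qzeta q x = x / (1 - x) + lambert q x - lambert q (1 / x)"
proof -
  define P' where "P' = deriv (\<lambda>x. qpinf x q)"
  have nz: "qpinf x q \<noteq> 0" "qpinf (q / x) q \<noteq> 0"
    using t by (auto simp: qtheta_def)
  have dP: "((\<lambda>x. qpinf x q) has_field_derivative P' x) (at x)" for x
    unfolding P'_def by (rule holomorphic_derivI[OF qpinf_holomorphic[OF q, of UNIV]]) auto
  have "((\<lambda>x. qpinf (q / x) q) has_field_derivative P' (q / x) * (- q / x ^ 2)) (at x)"
    by (rule DERIV_chain2[OF dP]) (use x in \<open>auto intro!: derivative_eq_intros simp: power2_eq_square\<close>)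
  from DERIV_mult[OF dP this]
  have "(qtheta q has_field_derivative
      P' x * qpinf (q / x) q + P' (q / x) * (- q / x ^ 2) * qpinf x q) (at x)"
    unfolding qtheta_def[abs_def] .
  hence "deriv (qtheta q) x = P' x * qpinf (q / x) q + P' (q / x) * (- q / x ^ 2) * qpinf x q"
    by (rule DERIV_imp_deriv)
  hence 1: "qzeta q x = - x * P' x / qpinf x q - (- (q / x) * P' (q / x) / qpinf (q / x) q)"
    unfolding qzeta_def using x nz by (simp add: qtheta_def field_simps power2_eq_square)
  have s1: "(\<lambda>n. x * q ^ n / (1 - x * q ^ n)) sums (- x * P' x / qpinf x q)"
    unfolding P'_def by (rule qpinf_logderiv_sums[OF q nz(1)])
  have s2: "(\<lambda>n. q / x * q ^ n / (1 - q / x * q ^ n)) sums (- (q / x) * P' (q / x) / qpinf (q / x) q)"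
    unfolding P'_def by (rule qpinf_logderiv_sums[OF q nz(2)])
  have "- x * P' x / qpinf x q = (\<Sum>n. x * q ^ n / (1 - x * q ^ n))"
    using s1 by (rule sums_unique)
  also have "\<dots> = (\<Sum>n. x * q ^ Suc n / (1 - x * q ^ Suc n)) + x * q ^ 0 / (1 - x * q ^ 0)"
    using suminf_split_head[OF sums_summable[OF s1]] by simp
  finally have 2: "- x * P' x / qpinf x q =
      x / (1 - x) + (\<Sum>n. x * q ^ Suc n / (1 - x * q ^ Suc n))" by simp
  have 3: "- (q / x) * P' (q / x) / qpinf (q / x) q =
      (\<Sum>n. 1 / x * q ^ Suc n / (1 - 1 / x * q ^ Suc n))"
    using sums_unique[OF s2] by simp
  show ?thesis unfolding lambert_def 1 2 3 ..
qed

end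

section \<open>The nonterminating 6\<phi>5 sum\<close>

text \<open>Here x stands for q^n and w for the argument of the series; this is
  \<open>vwp_step\<close> with common factors and denominators removed. As q enters only through a
  q, the hypothesis eliminates it.\<close>

lemma very_well_poised_polynomial_identity:
  fixes a b c d w x q :: complex
  assumes "a * q = w * b * c * d"
  shows "(1 - a * q * x ^ 2) * (1 - a * x) * x * (1 - w * d) * (1 - w * c) * (1 - w * b)
      - (1 - w) * (1 - a * x ^ 2) * ((1 - w * c * d * x) * (1 - w * b * d * x) * (1 - w * b * c * x)) =
    (1 - a * x) * (1 - b * x) * (1 - c * x) * (1 - d * x) * w * (1 - a * q * w * x)
      - (1 - x) * (1 - a * w * x) * ((1 - w * c * d * x) * (1 - w * b * d * x) * (1 - w * b * c * x))"
  unfolding assms by (simp add: algebra_simps power2_eq_square)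

lemma very_well_poised_rational_identity:
  fixes a b c d w x q :: complex
  assumes "a * q = w * b * c * d" and "1 - w \<noteq> 0"
    and "1 - w * c * d * x \<noteq> 0" "1 - w * b * d * x \<noteq> 0" "1 - w * b * c * x \<noteq> 0"
  shows "(1 - a * q * x ^ 2) * (1 - a * x) * x * (1 - w * d) * (1 - w * c) * (1 - w * b) /
        ((1 - w) * ((1 - w * c * d * x) * (1 - w * b * d * x) * (1 - w * b * c * x))) - (1 - a * x ^ 2) =
    (1 - a * x) * (1 - b * x) * (1 - c * x) * (1 - d * x) * w /
        ((1 - w * c * d * x) * (1 - w * b * d * x) * (1 - w * b * c * x)) * (1 - a * w * (q * x)) / (1 - w)
      - (1 - x) * (1 - a * w * x) / (1 - w)"
proof -
  define Y where "Y = (1 - w * c * d * x) * (1 - w * b * d * x) * (1 - w * b * c * x)"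
  have Y: "Y \<noteq> 0" using assms by (simp add: Y_def)
  define K where "K = (1 - a * q * x ^ 2) * (1 - a * x) * x * (1 - w * d) * (1 - w * c) * (1 - w * b)"
  define L where "L = (1 - a * x) * (1 - b * x) * (1 - c * x) * (1 - d * x) * w"
  have eq: "K - (1 - w) * (1 - a * x ^ 2) * Y = L * (1 - a * q * w * x) - (1 - x) * (1 - a * w * x) * Y"
    unfolding K_def L_def Y_def by (rule very_well_poised_polynomial_identity[OF assms(1)])
  have "K / ((1 - w) * Y) - (1 - a * x ^ 2) = (K - (1 - w) * (1 - a * x ^ 2) * Y) / ((1 - w) * Y)"
    using Y assms(2) by (simp add: diff_divide_distrib)
  also have "\<dots> = L / Y * (1 - a * w * (q * x)) / (1 - w) - (1 - x) * (1 - a * w * x) / (1 - w)"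
    unfolding eq using Y assms(2) by (simp add: diff_divide_distrib mult_ac)
  finally show ?thesis unfolding K_def L_def Y_def .
qed

text \<open>
  The sequence \<open>e\<close> stands for \<open>(d; q)\<^sub>n\<close>, or for \<open>(q; q)\<^sub>n\<^sub>-\<^sub>1\<close>, its quotient by
  \<open>1 - d\<close> at \<open>d = 1\<close>. The factor \<open>1 - a q\<^sup>2\<^sup>n\<close> is split off since the certificate divides by it.
\<close>

definition vwp_core ::
  "(nat \<Rightarrow> complex) \<Rightarrow> complex \<Rightarrow> complex \<Rightarrow> complex \<Rightarrow> complex \<Rightarrow> complex \<Rightarrow> nat \<Rightarrow> complex" where
  "vwp_core e q b c d a n = qpoch a q n / (1 - a) * qpoch b q n * qpoch c q n * e n /
     (qpoch q q n * qpoch (a * q / b) q n * qpoch (a * q / c) q n * qpoch (a * q / d) q n)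
     * (a * q / (b * c * d)) ^ n"

definition vwp_term where
  "vwp_term e q b c d a n = (1 - a * q ^ (2 * n)) * vwp_core e q b c d a n"

text \<open>
  The certificate comes from the ansatz that the term is multiplied by \<open>1 - q\<^sup>n\<close> and a linear
  polynomial in \<open>q\<^sup>n\<close>, the shift \<open>a \<rightarrow> a q\<close> acting with \<open>b, c, d\<close> fixed.
\<close>

definition vwp_cert where
  "vwp_cert e q b c d a n = vwp_core e q b c d a n * (1 - q ^ n)
     * (1 - a * (a * q / (b * c * d)) * q ^ n) / (1 - a * q / (b * c * d))"

text \<open>This is the product side of Rogers' sum at a divided by the product side at a q.\<close>

definition vwp_ratio where
  "vwp_ratio q b c d a =
     (1 - a * q) * (1 - a * q / (c * d)) * (1 - a * q / (b * d)) * (1 - a * q / (b * c))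
     / ((1 - a * q / b) * (1 - a * q / c) * (1 - a * q / d) * (1 - a * q / (b * c * d)))"

section \<open>Convergence and evaluation of the very-well-poised series\<close>

locale vwp =
  fixes q b c d a :: complex
  assumes q: "norm q < 1" and bcd: "b \<noteq> 0" "c \<noteq> 0" "d \<noteq> 0"
    and a1: "\<And>j. a * q ^ j \<noteq> 1"
    and ab: "\<And>j. a * q / b * q ^ j \<noteq> 1" and ac: "\<And>j. a * q / c * q ^ j \<noteq> 1"
    and ad: "\<And>j. a * q / d * q ^ j \<noteq> 1"
    and w1: "norm (a * q / (b * c * d)) < 1"
begin

text \<open>Stability under a -> a q^N permits the recurrence to be iterated.\<close>

lemma shifted: "vwp q b c d (a * q ^ N)"
proof
  show "a * q ^ N * q ^ j \<noteq> 1" for j using a1[of "N + j"] by (simp add: power_add mult_ac)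
  show "a * q ^ N * q / b * q ^ j \<noteq> 1" for j using ab[of "N + j"] by (simp add: power_add mult_ac)
  show "a * q ^ N * q / c * q ^ j \<noteq> 1" for j using ac[of "N + j"] by (simp add: power_add mult_ac)
  show "a * q ^ N * q / d * q ^ j \<noteq> 1" for j using ad[of "N + j"] by (simp add: power_add mult_ac)
  have "norm (a * q ^ N * q / (b * c * d)) = norm (a * q / (b * c * d)) * norm q ^ N"
    by (simp add: norm_mult norm_divide norm_power)
  also have "\<dots> \<le> norm (a * q / (b * c * d)) * 1"
    using q by (intro mult_left_mono power_le_one) auto
  finally show "norm (a * q ^ N * q / (b * c * d)) < 1" using w1 by simp
qed (use q bcd in auto)

lemma shifted_Suc: "vwp q b c d (a * q)"
  using shifted[of 1] by simp

lemma w_neq_1: "1 - a * q / (b * c * d) \<noteq> 0"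
  using w1 by auto

text \<open>The recurrence of \<open>e\<close> is required only at the given \<open>n\<close>: for d
  = 1 and \<open>e n\<close> = (q;q)_{n-1} it fails at n = 0 but holds from n = 1 on.\<close>

lemma vwp_step:
  assumes e: "e (Suc n) = e n * (1 - d * q ^ n)"
  shows "vwp_ratio q b c d a * vwp_term e q b c d (a * q) n - vwp_term e q b c d a n =
    vwp_cert e q b c d a (Suc n) - vwp_cert e q b c d a n"
proof -
  define w where "w = a * q / (b * c * d)"
  define x where "x = q ^ n"
  define s where "s = vwp_core e q b c d a n"
  have B: "a * q / b = w * c * d" and C: "a * q / c = w * b * d" and D: "a * q / d = w * b * c"
    and BC: "a * q / (b * c) = w * d" and BD: "a * q / (b * d) = w * c" and CD: "a * q / (c * d) = w * b"
    and aq: "a * q = w * b * c * d"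
    using bcd by (simp_all add: w_def)
  have nz: "1 - w * c * d * x \<noteq> 0" "1 - w * b * d * x \<noteq> 0" "1 - w * b * c * x \<noteq> 0"
    "1 - w * c * d \<noteq> 0" "1 - w * b * d \<noteq> 0" "1 - w * b * c \<noteq> 0"
    using ab[of n] ac[of n] ad[of n] ab[of 0] ac[of 0] ad[of 0] unfolding B C D x_def by auto
  have aq1: "1 - a \<noteq> 0" "1 - a * q \<noteq> 0" using a1[of 0] a1[of 1] by auto
  have w1': "1 - w \<noteq> 0" using w_neq_1 by (simp add: w_def)
  have qx: "1 - q * x \<noteq> 0" using power_Suc_neq_1[OF q, of n] by (simp add: x_def)
  have sSuc: "vwp_core e q b c d a (Suc n) =
      s * ((1 - a * x) * (1 - b * x) * (1 - c * x) * (1 - d * x) * w /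
      ((1 - w * c * d * x) * (1 - w * b * d * x) * (1 - w * b * c * x))) / (1 - q * x)"
    unfolding s_def vwp_core_def B C D e qpoch_Suc power_Suc w_def[symmetric] x_def[symmetric]
    by (simp add: mult_ac)
  have shift: "qpoch (y * q) q n = qpoch y q n * (1 - y * x) / (1 - y)" if "1 - y \<noteq> 0" for y
    using qpoch_Suc_left[of y q n] that by (simp add: qpoch_Suc x_def)
  have sa: "vwp_core e q b c d (a * q) n =
      s * ((1 - a * x) * x * ((1 - w * c * d) * (1 - w * b * d) * (1 - w * b * c))
      / ((1 - w * c * d * x) * (1 - w * b * d * x) * (1 - w * b * c * x))) / (1 - a * q)"
  proof -
    have e1: "a * q * q / b = w * c * d * q" "a * q * q / c = w * b * d * q" "a * q * q / d = w * b * c * q"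
      "a * q * q / (b * c * d) = w * q"
      using bcd unfolding aq by simp_all
    show ?thesis
      unfolding s_def vwp_core_def e1 B C D w_def[symmetric] shift[OF nz(4)] shift[OF nz(5)] shift[OF nz(6)]
        shift[OF aq1(1)] power_mult_distrib
      using nz aq1 by (simp add: x_def power_mult[symmetric] mult_ac power_commutes)
  qed
  have "vwp_ratio q b c d a * vwp_term e q b c d (a * q) n =
      s * ((1 - a * q * x ^ 2) * (1 - a * x) * x * (1 - w * d) * (1 - w * c) * (1 - w * b) /
        ((1 - w) * ((1 - w * c * d * x) * (1 - w * b * d * x) * (1 - w * b * c * x))))"
    unfolding vwp_ratio_def vwp_term_def sa B C D BC BD CD w_def[symmetric]
    using nz aq1 w1' by (simp add: x_def power_mult[symmetric] mult_ac)
  moreover have "vwp_term e q b c d a n = s * (1 - a * x ^ 2)"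
    by (simp add: vwp_term_def s_def x_def power_mult[symmetric] mult_ac)
  moreover have "vwp_cert e q b c d a (Suc n) =
      s * ((1 - a * x) * (1 - b * x) * (1 - c * x) * (1 - d * x) * w /
        ((1 - w * c * d * x) * (1 - w * b * d * x) * (1 - w * b * c * x)) * (1 - a * w * (q * x)) / (1 - w))"
    unfolding vwp_cert_def sSuc w_def[symmetric] power_Suc x_def[symmetric] using qx by simp
  moreover have "vwp_cert e q b c d a n = s * ((1 - x) * (1 - a * w * x) / (1 - w))"
    unfolding vwp_cert_def w_def[symmetric] x_def[symmetric] s_def by simp
  ultimately show ?thesis
    using very_well_poised_rational_identity[OF aq w1' nz(1-3)]
    by (simp only: right_diff_distrib[symmetric])
qed

text \<open>\<open>K\<close> must not depend on \<open>N\<close>, since the tails are estimated as N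
  tends to infinity. The division by 1 - a q^N is controlled by the lower bound for blocks of length
  1.\<close>

lemma vwp_core_bound:
  assumes e: "\<And>n. norm (e n) \<le> M"
  shows "\<exists>K\<ge>0. \<forall>N n.
    norm (vwp_core e q b c d (a * q ^ N) n) \<le> K * norm (a * q / (b * c * d) * q ^ N) ^ n"
proof -
  obtain Ma where Ma: "Ma > 0" "\<And>n m. norm (qpoch (a * q ^ m) q n) \<le> Ma"
    using qpoch_bounded[OF q, of a] by metis
  obtain Mb where Mb: "Mb > 0" "\<And>n m. norm (qpoch (b * q ^ m) q n) \<le> Mb"
    using qpoch_bounded[OF q, of b] by metis
  obtain Mc where Mc: "Mc > 0" "\<And>n m. norm (qpoch (c * q ^ m) q n) \<le> Mc"
    using qpoch_bounded[OF q, of c] by metis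
  obtain La where La: "La > 0" "\<And>n m. norm (qpoch (a * q ^ m) q n) \<ge> La"
    using qpoch_bounded_below[OF q a1] by metis
  obtain Lq where Lq: "Lq > 0" "\<And>n m. norm (qpoch (q * q ^ m) q n) \<ge> Lq"
    using qpoch_bounded_below[OF q power_Suc_neq_1[OF q]] by metis
  obtain Lb where Lb: "Lb > 0" "\<And>n m. norm (qpoch (a * q / b * q ^ m) q n) \<ge> Lb"
    using qpoch_bounded_below[OF q ab] by metis
  obtain Lc where Lc: "Lc > 0" "\<And>n m. norm (qpoch (a * q / c * q ^ m) q n) \<ge> Lc"
    using qpoch_bounded_below[OF q ac] by metis
  obtain Ld where Ld: "Ld > 0" "\<And>n m. norm (qpoch (a * q / d * q ^ m) q n) \<ge> Ld"
    using qpoch_bounded_below[OF q ad] by metis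
  have M: "M \<ge> 0" using e[of 0] norm_ge_zero order_trans by blast
  define K where "K = Ma / La * Mb * Mc * M / (Lq * Lb * Lc * Ld)"
  have "norm (vwp_core e q b c d (a * q ^ N) n) \<le> K * norm (a * q / (b * c * d) * q ^ N) ^ n" for N n
  proof -
    have eqs: "a * q ^ N * q / b = a * q / b * q ^ N" "a * q ^ N * q / c = a * q / c * q ^ N"
      "a * q ^ N * q / d = a * q / d * q ^ N" "a * q ^ N * q / (b * c * d) = a * q / (b * c * d) * q ^ N"
      by (simp_all add: mult_ac)
    have "norm (vwp_core e q b c d (a * q ^ N) n) =
        norm (qpoch (a * q ^ N) q n) / norm (1 - a * q ^ N) * norm (qpoch b q n) * norm (qpoch c q n) * norm (e n) /
        (norm (qpoch q q n) * norm (qpoch (a * q / b * q ^ N) q n) * norm (qpoch (a * q / c * q ^ N) q n)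
          * norm (qpoch (a * q / d * q ^ N) q n)) * norm (a * q / (b * c * d) * q ^ N) ^ n"
      unfolding vwp_core_def eqs by (simp only: norm_mult norm_divide norm_power)
    also have "\<dots> \<le> K * norm (a * q / (b * c * d) * q ^ N) ^ n"
      unfolding K_def
      by (intro mult_right_mono frac_le mult_mono mult_nonneg_nonneg mult_pos_pos divide_nonneg_nonneg e)
         (use Ma Mb(1) Mb(2)[of 0] Mc(1) Mc(2)[of 0] La(1) La(2)[of N 1] Lq(1) Lq(2)[of 0] Lb Lc Ld M
           in \<open>auto simp: qpoch_Suc less_imp_le\<close>)
    finally show ?thesis .
  qed
  moreover have "K \<ge> 0" unfolding K_def using Ma Mb Mc La Lq Lb Lc Ld M by auto
  ultimately show ?thesis by blast
qed

lemma vwp_term_bound: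
  assumes e: "\<And>n. norm (e n) \<le> M"
  shows "\<exists>K\<ge>0. \<forall>N n.
    norm (vwp_term e q b c d (a * q ^ N) n) \<le> K * norm (a * q / (b * c * d) * q ^ N) ^ n"
proof -
  obtain K where K: "K \<ge> 0"
    "\<And>N n. norm (vwp_core e q b c d (a * q ^ N) n) \<le> K * norm (a * q / (b * c * d) * q ^ N) ^ n"
    using vwp_core_bound[of e M, OF e] by blast
  have "norm (vwp_term e q b c d (a * q ^ N) n) \<le>
      (1 + norm a) * K * norm (a * q / (b * c * d) * q ^ N) ^ n" for N n
  proof -
    have "norm (a * q ^ N * q ^ (2 * n)) \<le> norm a * 1"
      unfolding mult.assoc power_add[symmetric] norm_mult norm_power
      using q by (intro mult_left_mono power_le_one) auto
    hence "norm (1 - a * q ^ N * q ^ (2 * n)) \<le> 1 + norm a"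
      using norm_triangle_ineq4[of 1 "a * q ^ N * q ^ (2 * n)"] by simp
    hence "norm (vwp_term e q b c d (a * q ^ N) n) \<le>
        (1 + norm a) * (K * norm (a * q / (b * c * d) * q ^ N) ^ n)"
      unfolding vwp_term_def norm_mult[of "1 - _"] by (intro mult_mono K) auto
    thus ?thesis by simp
  qed
  thus ?thesis using K(1) by (intro exI[of _ "(1 + norm a) * K"]) auto
qed

lemma vwp_term_summable:
  assumes e: "\<And>n. norm (e n) \<le> M"
  shows "summable (\<lambda>n. norm (vwp_term e q b c d a n))"
proof -
  obtain K where K: "K \<ge> 0"
    "\<And>N n. norm (vwp_term e q b c d (a * q ^ N) n) \<le> K * norm (a * q / (b * c * d) * q ^ N) ^ n"
    using vwp_term_bound[of e M, OF e] by blast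
  have "summable (\<lambda>n. K * norm (a * q / (b * c * d)) ^ n)"
    using w1 by (intro summable_mult summable_geometric) auto
  thus ?thesis
    by (rule summable_comparison_test'[where N = 0]) (use K(2)[of 0] in simp)
qed

text \<open>Every term of index at least 1 contains the argument, hence a factor q^N; one such
  factor is kept and the remaining ones are bounded by 1.\<close>

lemma vwp_tail_tendsto_0:
  assumes e: "\<And>n. norm (e n) \<le> M"
  shows "(\<lambda>N. \<Sum>n. vwp_term e q b c d (a * q ^ N) (Suc n)) \<longlonglongrightarrow> 0"
proof -
  obtain K where K: "K \<ge> 0"
    "\<And>N n. norm (vwp_term e q b c d (a * q ^ N) n) \<le> K * norm (a * q / (b * c * d) * q ^ N) ^ n"
    using vwp_term_bound[of e M, OF e] by blast
  define r where "r = norm (a * q / (b * c * d))"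
  have r: "r \<ge> 0" "r < 1" using w1 by (simp_all add: r_def)
  have s: "summable (\<lambda>n. K * r * r ^ n)"
    using r by (intro summable_mult summable_geometric) auto
  have bound:
    "norm (\<Sum>n. vwp_term e q b c d (a * q ^ N) (Suc n)) \<le> (\<Sum>n. K * r * r ^ n) * norm q ^ N" for N
  proof -
    have le: "norm (vwp_term e q b c d (a * q ^ N) (Suc n)) \<le> K * r * r ^ n * norm q ^ N" for n
    proof -
      have "norm (vwp_term e q b c d (a * q ^ N) (Suc n)) \<le> K * (r * norm q ^ N) ^ Suc n"
        using K(2)[of N "Suc n"] by (simp only: norm_mult[of _ "q ^ N"] norm_power r_def)
      also have "\<dots> = K * r * r ^ n * (norm q ^ N * (norm q ^ N) ^ n)"
        by (simp add: power_mult_distrib mult_ac)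
      also have "\<dots> \<le> K * r * r ^ n * (norm q ^ N * 1)"
        using K(1) r q by (intro mult_left_mono power_le_one mult_nonneg_nonneg) (auto simp: power_le_one)
      finally show ?thesis by simp
    qed
    have s': "summable (\<lambda>n. K * r * r ^ n * norm q ^ N)"
      by (intro summable_mult2 s)
    have s'': "summable (\<lambda>n. norm (vwp_term e q b c d (a * q ^ N) (Suc n)))"
      by (rule summable_comparison_test'[OF s', where N = 0]) (use le in simp)
    have "norm (\<Sum>n. vwp_term e q b c d (a * q ^ N) (Suc n)) \<le> (\<Sum>n. K * r * r ^ n * norm q ^ N)"
      using summable_norm[OF s''] suminf_le[OF le s'' s'] by linarith
    also have "\<dots> = (\<Sum>n. K * r * r ^ n) * norm q ^ N"
      using suminf_mult2[OF s] by simp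
    finally show ?thesis .
  qed
  have "(\<lambda>N. (\<Sum>n. K * r * r ^ n) * norm q ^ N) \<longlonglongrightarrow> 0"
    using q by (intro tendsto_mult_right_zero LIMSEQ_power_zero) auto
  thus ?thesis by (rule Lim_null_comparison[OF always_eventually[OF allI[OF bound]]])
qed

lemma vwp_cert_tendsto_0:
  assumes e: "\<And>n. norm (e n) \<le> M"
  shows "vwp_cert e q b c d a \<longlonglongrightarrow> 0"
proof -
  define w where "w = a * q / (b * c * d)"
  obtain K where K: "K \<ge> 0"
    "\<And>N n. norm (vwp_core e q b c d (a * q ^ N) n) \<le> K * norm (a * q / (b * c * d) * q ^ N) ^ n"
    using vwp_core_bound[of e M, OF e] by blast
  have "(\<lambda>n. K * norm w ^ n) \<longlonglongrightarrow> 0"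
    using w1 by (intro tendsto_mult_right_zero LIMSEQ_power_zero) (auto simp: w_def)
  moreover have bound: "norm (vwp_core e q b c d a n) \<le> K * norm w ^ n" for n
    using K(2)[of 0 n] by (simp add: w_def)
  ultimately have core: "vwp_core e q b c d a \<longlonglongrightarrow> 0"
    by (intro Lim_null_comparison[OF always_eventually[OF allI[OF bound]]])
  have qn: "(\<lambda>n. q ^ n) \<longlonglongrightarrow> 0" using q by (rule LIMSEQ_power_zero)
  have "(\<lambda>n. vwp_core e q b c d a n * (1 - q ^ n) * (1 - a * w * q ^ n) / (1 - w)) \<longlonglongrightarrow>
      0 * (1 - 0) * (1 - a * w * 0) / (1 - w)"
    using w_neq_1 by (intro tendsto_intros core qn) (simp add: w_def)
  thus ?thesis by (simp add: vwp_cert_def[abs_def] w_def)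
qed

text \<open>Summation of \<open>vwp_step\<close>: the certificate tends to 0 and vanishes at n = 0
  through its factor 1 - q^n, so both boundary contributions are 0.\<close>

lemma vwp_term_sum_step:
  assumes e: "\<And>n. norm (e n) \<le> M" and rec: "\<And>n. e (Suc n) = e n * (1 - d * q ^ n)"
  shows "(\<Sum>n. vwp_term e q b c d a n) = vwp_ratio q b c d a * (\<Sum>n. vwp_term e q b c d (a * q) n)"
proof -
  interpret s: vwp q b c d "a * q" by (rule shifted_Suc)
  have "(\<lambda>n. vwp_cert e q b c d a (Suc n) - vwp_cert e q b c d a n) sums (0 - vwp_cert e q b c d a 0)"
    by (rule telescope_sums[OF vwp_cert_tendsto_0[OF e]])
  hence "(\<lambda>n. vwp_ratio q b c d a * vwp_term e q b c d (a * q) n - vwp_term e q b c d a n) sums 0"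
    unfolding vwp_step[OF rec] by (simp add: vwp_cert_def)
  moreover have "(\<lambda>n. vwp_ratio q b c d a * vwp_term e q b c d (a * q) n - vwp_term e q b c d a n) sums
      (vwp_ratio q b c d a * (\<Sum>n. vwp_term e q b c d (a * q) n) - (\<Sum>n. vwp_term e q b c d a n))"
    using summable_norm_cancel[OF vwp_term_summable[OF e]]
      summable_norm_cancel[OF s.vwp_term_summable[OF e]]
    by (intro sums_diff sums_mult summable_sums)
  ultimately show ?thesis using sums_unique2 by fastforce
qed

text \<open>Iteration gives the finite product \<open>R N\<close> times the series at a q^N. That
  series tends to its initial term 1, while \<open>R N\<close> tends to the quotient of infinite
  products.\<close>

theorem rogers_6phi5_sum:
  "(\<lambda>n. (1 - a * q ^ (2 * n)) * qpoch a q n / (1 - a) * qpoch b q n * qpoch c q n * qpoch d q n /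
      (qpoch q q n * qpoch (a * q / b) q n * qpoch (a * q / c) q n * qpoch (a * q / d) q n)
      * (a * q / (b * c * d)) ^ n) sums
    (qpinf (a * q) q * qpinf (a * q / (c * d)) q * qpinf (a * q / (b * d)) q * qpinf (a * q / (b * c)) q /
      (qpinf (a * q / b) q * qpinf (a * q / c) q * qpinf (a * q / d) q * qpinf (a * q / (b * c * d)) q))"
proof -
  define t where "t = vwp_term (qpoch d q) q b c d"
  define R where "R = (\<lambda>N. qpoch (a * q) q N * qpoch (a * q / (c * d)) q N * qpoch (a * q / (b * d)) q N
      * qpoch (a * q / (b * c)) q N / (qpoch (a * q / b) q N * qpoch (a * q / c) q N * qpoch (a * q / d) q N
      * qpoch (a * q / (b * c * d)) q N))"
  obtain M where M: "\<And>n. norm (qpoch d q n) \<le> M"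
    using qpoch_bounded[OF q, of d] by (metis mult_1_right power_0)
  have R_Suc: "R (Suc N) = R N * vwp_ratio q b c d (a * q ^ N)" for N
  proof -
    have eqs: "a * q ^ N * q / (c * d) = a * q / (c * d) * q ^ N" "a * q ^ N * q / (b * d) = a * q / (b * d) * q ^ N"
      "a * q ^ N * q / (b * c) = a * q / (b * c) * q ^ N" "a * q ^ N * q / b = a * q / b * q ^ N"
      "a * q ^ N * q / c = a * q / c * q ^ N" "a * q ^ N * q / d = a * q / d * q ^ N"
      "a * q ^ N * q / (b * c * d) = a * q / (b * c * d) * q ^ N" "a * q ^ N * q = a * q * q ^ N"
      by (simp_all add: mult_ac)
    show ?thesis unfolding R_def vwp_ratio_def eqs qpoch_Suc by (simp add: mult_ac)
  qed
  have step: "(\<Sum>n. t (a * q ^ N) n) = vwp_ratio q b c d (a * q ^ N) * (\<Sum>n. t (a * q ^ Suc N) n)" for N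
  proof -
    interpret s: vwp q b c d "a * q ^ N" by (rule shifted)
    show ?thesis
      using s.vwp_term_sum_step[of "qpoch d q", OF M] by (simp add: t_def qpoch_Suc mult_ac)
  qed
  have "(\<Sum>n. t a n) = R N * (\<Sum>n. t (a * q ^ N) n)" for N
  proof (induction N)
    case 0
    thus ?case by (simp add: R_def)
  next
    case (Suc N)
    show ?case unfolding Suc step[of N] R_Suc by simp
  qed
  moreover have split: "(\<Sum>n. t (a * q ^ N) n) = 1 + (\<Sum>n. t (a * q ^ N) (Suc n))" for N
  proof -
    interpret s: vwp q b c d "a * q ^ N" by (rule shifted)
    have "summable (t (a * q ^ N))"
      unfolding t_def by (rule summable_norm_cancel[OF s.vwp_term_summable[OF M]])
    moreover have "t (a * q ^ N) 0 = 1"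
      using a1[of N] by (simp add: t_def vwp_term_def vwp_core_def)
    ultimately show ?thesis using suminf_split_head[of "t (a * q ^ N)"] by simp
  qed
  ultimately have eq: "(\<lambda>N. R N * (1 + (\<Sum>n. t (a * q ^ N) (Suc n)))) = (\<lambda>N. \<Sum>n. t a n)"
    by metis
  have "(\<lambda>N. R N * (1 + (\<Sum>n. t (a * q ^ N) (Suc n)))) \<longlonglongrightarrow>
     (qpinf (a * q) q * qpinf (a * q / (c * d)) q * qpinf (a * q / (b * d)) q * qpinf (a * q / (b * c)) q /
      (qpinf (a * q / b) q * qpinf (a * q / c) q * qpinf (a * q / d) q * qpinf (a * q / (b * c * d)) q)) * (1 + 0)"
    (is "_ \<longlonglongrightarrow> ?L * _")
  proof (unfold R_def, intro tendsto_intros qpoch_tendsto_qpinf q)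
    show "(\<lambda>N. \<Sum>n. t (a * q ^ N) (Suc n)) \<longlonglongrightarrow> 0"
      unfolding t_def by (rule vwp_tail_tendsto_0[OF M])
    have "a * q / (b * c * d) * q ^ j \<noteq> 1" for j
    proof
      assume "a * q / (b * c * d) * q ^ j = 1"
      moreover have "norm (a * q / (b * c * d) * q ^ j) \<le> norm (a * q / (b * c * d)) * 1"
        unfolding norm_mult[of _ "q ^ j"] norm_power using q by (intro mult_left_mono power_le_one) auto
      ultimately show False using w1 by simp
    qed
    thus "qpinf (a * q / b) q * qpinf (a * q / c) q * qpinf (a * q / d) q * qpinf (a * q / (b * c * d)) q \<noteq> 0"
      using ab ac ad unfolding mult_eq_0_iff qpinf_eq_0_iff[OF q] by blast
  qed
  hence "(\<Sum>n. t a n) = ?L"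
    unfolding eq using LIMSEQ_unique[OF tendsto_const] by fastforce
  moreover have "summable (t a)"
    unfolding t_def by (rule summable_norm_cancel[OF vwp_term_summable[OF M]])
  ultimately have "t a sums ?L" using summable_sums by metis
  thus ?thesis unfolding t_def vwp_term_def vwp_core_def by (simp add: mult_ac)
qed

end

text \<open>At d = 1 the ratio is 1 and telescoping starts at index 1, so the recurrence adds the
  boundary value of the certificate instead of multiplying. The iterated boundary values form the
  series on the left.\<close>

theorem rogers_6phi5_sum_derivative:
  assumes "vwp q b c 1 a"
  shows "(\<lambda>n. a * q ^ Suc n / (1 - a * q ^ Suc n)
      + a / (b * c) * q ^ Suc n / (1 - a / (b * c) * q ^ Suc n)
      - a / b * q ^ Suc n / (1 - a / b * q ^ Suc n) - a / c * q ^ Suc n / (1 - a / c * q ^ Suc n)) sums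
    (\<Sum>n. vwp_term (\<lambda>n. qpoch q q (n - 1)) q b c 1 a (Suc n))"
proof -
  interpret vwp q b c 1 a by fact
  define e where "e = (\<lambda>n. qpoch q q (n - 1))"
  define t where "t = vwp_term e q b c 1"
  \<comment> \<open>This is minus the logarithmic derivative in d of \<open>vwp_ratio\<close> at d =
    1. It is found below as the certificate at index 1, decomposed into partial fractions.\<close>
  define r where "r = (\<lambda>a. a * q / (1 - a * q) + a * q / (b * c) / (1 - a * q / (b * c))
     - a * q / b / (1 - a * q / b) - a * q / c / (1 - a * q / c))"
  obtain M where "\<And>n m. norm (qpoch (q * q ^ m) q n) \<le> M"
    using qpoch_bounded[OF q, of q] by metis
  hence M: "norm (e n) \<le> M" for n
    unfolding e_def by (metis mult_1_right power_0)
  have step: "(\<Sum>n. t (a * q ^ N) (Suc n)) = r (a * q ^ N) + (\<Sum>n. t (a * q ^ Suc N) (Suc n))" for N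
  proof -
    define A where "A = a * q ^ N"
    interpret s: vwp q b c 1 A unfolding A_def by (rule shifted)
    interpret s1: vwp q b c 1 "A * q" by (rule s.shifted_Suc)
    have ratio: "vwp_ratio q b c 1 A = 1"
      using s.a1[of 1] s.ab[of 0] s.ac[of 0] s.w_neq_1 by (simp add: vwp_ratio_def)
    \<comment> \<open>Truncated subtraction gives e 0 = e 1 = 1, so the recurrence begins at index
      1.\<close>
    have rec: "e (Suc (Suc n)) = e (Suc n) * (1 - 1 * q ^ Suc n)" for n
      by (simp add: e_def qpoch_Suc)
    have "(\<lambda>n. vwp_cert e q b c 1 A (Suc (Suc n)) - vwp_cert e q b c 1 A (Suc n)) sums
        (0 - vwp_cert e q b c 1 A (Suc 0))"
      by (rule telescope_sums[where f = "\<lambda>n. vwp_cert e q b c 1 A (Suc n)"])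
         (rule LIMSEQ_Suc[OF s.vwp_cert_tendsto_0[OF M]])
    hence 1: "(\<lambda>n. t (A * q) (Suc n) - t A (Suc n)) sums (- vwp_cert e q b c 1 A 1)"
      unfolding s.vwp_step[of e, OF rec, symmetric] ratio t_def by simp
    have 2: "(\<lambda>n. t (A * q) (Suc n) - t A (Suc n)) sums ((\<Sum>n. t (A * q) (Suc n)) - (\<Sum>n. t A (Suc n)))"
      unfolding t_def
      using summable_norm_cancel[OF s.vwp_term_summable[OF M]]
        summable_norm_cancel[OF s1.vwp_term_summable[OF M]]
      by (intro sums_diff summable_sums) (simp_all only: summable_Suc_iff)
    have "vwp_cert e q b c 1 A 1 = r A"
    proof -
      define w where "w = A * q / (b * c)"
      have eqs: "A * q / b = w * c" "A * q / c = w * b" "A * q = w * b * c"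
        using bcd by (simp_all add: w_def)
      have nz: "1 - w \<noteq> 0" "1 - w * c \<noteq> 0" "1 - w * b \<noteq> 0" "1 - w * b * c \<noteq> 0" "1 - A \<noteq> 0" "1 - q \<noteq> 0"
        using s.w_neq_1 s.ab[of 0] s.ac[of 0] s.a1[of 1] s.a1[of 0] power_Suc_neq_1[OF q, of 0]
        unfolding eqs(1,2) by (simp_all add: w_def[symmetric] eqs(3)[symmetric])
      have "vwp_cert e q b c 1 A 1 = (1 - b) * (1 - c) * w * (1 - w * (w * b * c)) /
          ((1 - w * c) * (1 - w * b) * (1 - w * b * c) * (1 - w))"
        unfolding vwp_cert_def vwp_core_def eqs(1,2) mult_1_right div_by_1 w_def[symmetric]
        using nz by (simp add: e_def qpoch_Suc eqs(3)) (use eqs(3) in \<open>simp add: mult_ac\<close>)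
      also have "\<dots> = w * b * c / (1 - w * b * c) + w / (1 - w) - w * c / (1 - w * c) - w * b / (1 - w * b)"
        unfolding add_frac_eq[OF nz(4,1)] diff_frac_eq[OF no_zero_divisors[OF nz(4,1)] nz(2)]
          diff_frac_eq[OF no_zero_divisors[OF no_zero_divisors[OF nz(4,1)] nz(2)] nz(3)]
        by (rule arg_cong2[of _ _ _ _ "(/)"]) (simp_all add: algebra_simps)
      also have "\<dots> = r A"
        unfolding r_def eqs(1,2) w_def[symmetric] by (simp only: eqs(3))
      finally show ?thesis .
    qed
    with sums_unique2[OF 1 2] have "(\<Sum>n. t A (Suc n)) = r A + (\<Sum>n. t (A * q) (Suc n))"
      by (simp add: algebra_simps)
    thus ?thesis by (simp add: A_def mult_ac)
  qed
  have "(\<Sum>n. t a (Suc n)) - (\<Sum>n. t (a * q ^ N) (Suc n)) = (\<Sum>i<N. r (a * q ^ i))" for N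
    by (induction N) (simp_all add: step[of N] algebra_simps, simp add: step)
  hence "(\<lambda>N. \<Sum>i<N. r (a * q ^ i)) = (\<lambda>N. (\<Sum>n. t a (Suc n)) - (\<Sum>n. t (a * q ^ N) (Suc n)))"
    by simp
  moreover have "(\<lambda>N. (\<Sum>n. t a (Suc n)) - (\<Sum>n. t (a * q ^ N) (Suc n))) \<longlonglongrightarrow> (\<Sum>n. t a (Suc n)) - 0"
    unfolding t_def by (intro tendsto_intros vwp_tail_tendsto_0[OF M])
  ultimately have "(\<lambda>i. r (a * q ^ i)) sums (\<Sum>n. t a (Suc n))"
    by (simp add: sums_def)
  moreover have "r (a * q ^ n) = a * q ^ Suc n / (1 - a * q ^ Suc n)
      + a / (b * c) * q ^ Suc n / (1 - a / (b * c) * q ^ Suc n)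
      - a / b * q ^ Suc n / (1 - a / b * q ^ Suc n) - a / c * q ^ Suc n / (1 - a / c * q ^ Suc n)" for n
    unfolding r_def by (simp add: mult_ac)
  ultimately show ?thesis unfolding t_def e_def by simp
qed

section \<open>Summation over WP-Bailey pairs\<close>

text \<open>Fubini over pairs: summable row sums of norms give absolute summability on the product,
  and the vanishing for n < j makes the sums in the other order finite.\<close>

lemma sums_lower_triangle:
  fixes F :: "nat \<Rightarrow> nat \<Rightarrow> 'a :: banach"
  assumes zero: "\<And>j n. n < j \<Longrightarrow> F j n = 0"
    and rows: "\<And>j. summable (\<lambda>n. norm (F j n))"
    and total: "summable (\<lambda>j. \<Sum>n. norm (F j n))"
  shows "(\<lambda>n. \<Sum>j\<le>n. F j n) sums (\<Sum>j. \<Sum>n. F j n)"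
proof -
  define f where "f = (\<lambda>(j, n). F j n)"
  have inf: "infsum (\<lambda>n. norm (F j n)) UNIV = (\<Sum>n. norm (F j n))" for j
    by (rule infsumI[OF norm_summable_imp_has_sum]) (use rows in \<open>simp_all add: summable_sums\<close>)
  have "(\<lambda>n. norm (F j n)) summable_on UNIV" for j
    using rows by (intro norm_summable_imp_summable_on) simp
  moreover have "(\<lambda>j. norm (\<Sum>n. norm (F j n))) summable_on UNIV"
    using total by (intro norm_summable_imp_summable_on) (simp add: suminf_nonneg rows)
  ultimately have "f abs_summable_on UNIV \<times> UNIV"
    unfolding Infinite_Sum.abs_summable_on_Sigma_iff f_def case_prod_conv inf by blast
  hence "f summable_on UNIV \<times> UNIV" by (rule abs_summable_summable)
  then obtain S where S: "(f has_sum S) (UNIV \<times> UNIV)" by (auto simp: summable_on_def)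
  have "((\<lambda>j. \<Sum>n. F j n) has_sum S) UNIV"
    by (rule has_sum_SigmaD[OF S])
       (auto simp: f_def intro!: norm_summable_imp_has_sum summable_sums summable_norm_cancel rows)
  hence "(\<lambda>j. \<Sum>n. F j n) sums S" by (rule has_sum_imp_sums)
  moreover have "((\<lambda>n. \<Sum>j\<le>n. F j n) has_sum S) UNIV"
  proof (rule has_sum_SigmaD[OF S[unfolded has_sum_swap[of f]]])
    fix n :: nat
    have "((\<lambda>j. F j n) has_sum (\<Sum>j\<le>n. F j n)) {..n}" by (rule has_sum_finite) simp
    also have "?this \<longleftrightarrow> ((\<lambda>j. F j n) has_sum (\<Sum>j\<le>n. F j n)) UNIV"
      by (rule has_sum_cong_neutral) (auto intro!: zero)
    finally show "((\<lambda>y. case (n, y) of (x, y) \<Rightarrow> f (y, x)) has_sum (\<Sum>j\<le>n. F j n)) UNIV"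
      by (simp add: f_def)
  qed
  hence "(\<lambda>n. \<Sum>j\<le>n. F j n) sums S" by (rule has_sum_imp_sums)
  ultimately show ?thesis by (simp add: sums_iff)
qed

section \<open>The coefficient of each alpha_j in the beta-series\<close>

locale wp_bailey_sum =
  fixes q a k z :: complex
  assumes q: "norm q < 1" and q0: "q \<noteq> 0" and a0: "a \<noteq> 0" and k0: "k \<noteq> 0" and z0: "z \<noteq> 0"
    and k1: "\<And>j. k * q ^ j \<noteq> 1" and a1: "\<And>j. a * q * q ^ j \<noteq> 1"
    and kz: "\<And>j. k * q / z * q ^ j \<noteq> 1" and w1: "norm (a * q / z) < 1"
begin

text \<open>The four products with square roots of k are already merged into the factor (1 - k
  q^(2n))/(1 - k) typical of very-well-poised series.\<close>

definition wp_beta_coeff where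
  "wp_beta_coeff n = (1 - k * q ^ (2 * n)) / (1 - k) * qpoch z q n * qpoch q q (n - 1) /
      (qpoch (k * q) q n * qpoch (k * q / z) q n) * (a * q / z) ^ n"

text \<open>Truncated subtraction makes \<open>wp_alpha_coeff 0 = 1\<close>.\<close>

definition wp_alpha_coeff where
  "wp_alpha_coeff n = qpoch z q n * qpoch q q (n - 1) / (qpoch (a * q) q n * qpoch (a * q / z) q n)
      * (a * q / z) ^ n"

definition wp_kernel where
  "wp_kernel n j =
     qpoch (k / a) q (n - j) * qpoch k q (n + j) / (qpoch q q (n - j) * qpoch (a * q) q (n + j))"

lemma az: "a * q / z * q ^ j \<noteq> 1"
proof
  assume "a * q / z * q ^ j = 1"
  moreover have "norm (a * q / z * q ^ j) \<le> norm (a * q / z) * 1"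
    unfolding norm_mult[of _ "q ^ j"] norm_power using q by (intro mult_left_mono power_le_one) auto
  ultimately show False using w1 by simp
qed

text \<open>For j = 0 the inner series has base k and parameters k/a, z, 1; its argument is then a
  q/z.\<close>

lemma vwp_0: "vwp q (k / a) z 1 k"
  by standard (use q a0 k0 z0 k1 k1[of "Suc _"] a1 kz w1 in \<open>auto simp: mult_ac\<close>)

lemma column_0_sums:
  "(\<lambda>n. wp_beta_coeff (Suc n) * wp_kernel (Suc n) 0) sums
     (lambert q k + lambert q (a / z) - lambert q a - lambert q (k / z))"
proof -
  interpret v: vwp q "k / a" z 1 k by (rule vwp_0)
  define t where "t = vwp_term (\<lambda>n. qpoch q q (n - 1)) q (k / a) z 1 k"
  have t: "t n = wp_beta_coeff n * wp_kernel n 0" for n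
  proof -
    have "k * q / (k / a) = a * q" "k * q / (k / a * z * 1) = a * q / z" using k0 a0 by simp_all
    thus ?thesis
      unfolding t_def vwp_term_def vwp_core_def wp_beta_coeff_def wp_kernel_def by (simp add: mult_ac)
  qed
  obtain M where "\<And>n m. norm (qpoch (q * q ^ m) q n) \<le> M"
    using qpoch_bounded[OF q, of q] by metis
  hence M: "norm (qpoch q q (n - 1)) \<le> M" for n
    by (metis mult_1_right power_0)
  have "summable t" unfolding t_def by (rule summable_norm_cancel[OF v.vwp_term_summable[OF M]])
  hence 1: "(\<lambda>n. t (Suc n)) sums (\<Sum>n. t (Suc n))" by (intro summable_sums) (simp only: summable_Suc_iff)
  have eqs: "k / (k / a * z) = a / z" "k / (k / a) = a" using k0 a0 by simp_all
  have k1': "k * q * q ^ n \<noteq> 1" for n using k1[of "Suc n"] by (simp add: mult_ac)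
  have az': "a / z * q * q ^ n \<noteq> 1" for n using az[of n] by simp
  have kz': "k / z * q * q ^ n \<noteq> 1" for n using kz[of n] by simp
  have "(\<Sum>n. t (Suc n)) = lambert q k + lambert q (a / z) - lambert q a - lambert q (k / z)"
    using rogers_6phi5_sum_derivative[OF vwp_0]
      sums_diff[OF sums_diff[OF sums_add[OF lambert_sums[OF q k1'] lambert_sums[OF q az']]
         lambert_sums[OF q a1]] lambert_sums[OF q kz']]
    unfolding eqs t_def by (rule sums_unique2)
  with 1 show ?thesis unfolding t by simp
qed

text \<open>With n = j + m every product splits off a part independent of m. What is left is Rogers'
  series with base k q^(2j) and parameters k/a, z q^j, q^j, again with argument a q/z. Positivity of
  j is needed to split (q;q)_{n-1}.\<close>

lemma column_sums:
  assumes j: "j > 0"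
  shows "(\<lambda>m. wp_beta_coeff (j + m) * wp_kernel (j + m) j) sums wp_alpha_coeff j"
proof -
  define K where "K = k * q ^ (2 * j)"
  have q2: "q ^ (2 * j) = q ^ j * q ^ j" by (simp add: mult_2 power_add)
  have eqs: "K * q / (k / a) = a * q * q ^ (2 * j)" "K * q / (z * q ^ j) = k * q / z * q ^ j"
    "K * q / q ^ j = k * q * q ^ j" "K * q / (k / a * (z * q ^ j) * q ^ j) = a * q / z"
    "K * q / (z * q ^ j * q ^ j) = k * q / z" "K * q / (k / a * q ^ j) = a * q * q ^ j"
    "K * q / (k / a * (z * q ^ j)) = a * q / z * q ^ j" "K * q = k * q * q ^ (2 * j)"
    unfolding K_def q2 using k0 a0 z0 q0 by (simp_all add: field_simps)
  have kq: "k * q * q ^ i \<noteq> 1" for i using k1[of "Suc i"] by (simp add: mult_ac)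
  interpret v: vwp q "k / a" "z * q ^ j" "q ^ j" K
  proof
    show "K * q ^ i \<noteq> 1" for i
      using k1[of "2 * j + i"] by (simp add: K_def power_add mult_ac)
    show "K * q / (k / a) * q ^ i \<noteq> 1" for i
      unfolding eqs(1-4) using a1[of "2 * j + i"] by (simp add: power_add mult_ac)
    show "K * q / (z * q ^ j) * q ^ i \<noteq> 1" for i
      unfolding eqs(1-4) using kz[of "j + i"] by (simp add: power_add mult_ac)
    show "K * q / q ^ j * q ^ i \<noteq> 1" for i
      unfolding eqs(1-4) using kq[of "j + i"] by (simp add: power_add mult_ac)
    show "norm (K * q / (k / a * (z * q ^ j) * q ^ j)) < 1"
      unfolding eqs(1-4) by (rule w1)
  qed (use q k0 a0 z0 q0 in auto)
  \<comment> \<open>The term m = 0, by which the series is normalised to begin with 1.\<close>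
  define X where "X = wp_beta_coeff j * wp_kernel j j"
  define t where "t = (\<lambda>m. (1 - K * q ^ (2 * m)) * qpoch K q m / (1 - K) * qpoch (k / a) q m
      * qpoch (z * q ^ j) q m * qpoch (q ^ j) q m / (qpoch q q m * qpoch (a * q * q ^ (2 * j)) q m
      * qpoch (k * q / z * q ^ j) q m * qpoch (k * q * q ^ j) q m) * (a * q / z) ^ m)"
  define P where "P = qpinf (k * q * q ^ (2 * j)) q * qpinf (k * q / z) q * qpinf (a * q * q ^ j) q
      * qpinf (a * q / z * q ^ j) q / (qpinf (a * q * q ^ (2 * j)) q * qpinf (k * q / z * q ^ j) q
      * qpinf (k * q * q ^ j) q * qpinf (a * q / z) q)"
  have tP: "t sums P"
    using v.rogers_6phi5_sum unfolding eqs(1-7) unfolding eqs(8) t_def P_def .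
  have K1: "1 - K \<noteq> 0" using k1[of "2 * j"] by (simp add: K_def)
  have term_eq: "wp_beta_coeff (j + m) * wp_kernel (j + m) j = X * t m" for m
  proof -
    have e1: "qpoch z q (j + m) = qpoch z q j * qpoch (z * q ^ j) q m"
      "qpoch (k * q) q (j + m) = qpoch (k * q) q j * qpoch (k * q * q ^ j) q m"
      "qpoch (k * q / z) q (j + m) = qpoch (k * q / z) q j * qpoch (k * q / z * q ^ j) q m"
      by (simp_all add: qpoch_add)
    have "j + m + j = 2 * j + m" "j + j = 2 * j" by simp_all
    hence e2: "qpoch k q (j + m + j) = qpoch k q (2 * j) * qpoch K q m"
      "qpoch (a * q) q (j + m + j) = qpoch (a * q) q (2 * j) * qpoch (a * q * q ^ (2 * j)) q m"
      by (simp_all only: qpoch_add[of _ _ "2 * j" m] K_def)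
    have e3: "qpoch q q (j + m - 1) = qpoch q q (j - 1) * qpoch (q ^ j) q m"
    proof -
      have "j + m - 1 = (j - 1) + m" using j by simp
      moreover have "q * q ^ (j - 1) = q ^ j" using j by (cases j) simp_all
      ultimately show ?thesis by (simp add: qpoch_add)
    qed
    have e4: "k * q ^ (2 * (j + m)) = K * q ^ (2 * m)" "k * q ^ (2 * j) = K"
      by (simp_all add: K_def power_add algebra_simps)
    have e5: "j + m - j = m" by simp
    show ?thesis
      unfolding X_def t_def wp_beta_coeff_def wp_kernel_def e1 e2 e3 e4 e5 power_add
      using K1 by (simp add: mult_2) (simp add: mult_ac)
  qed
  have "X * P = wp_alpha_coeff j"
  proof -
    have s1: "qpinf (k * q / z) q = qpoch (k * q / z) q j * qpinf (k * q / z * q ^ j) q"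
      "qpinf (a * q / z) q = qpoch (a * q / z) q j * qpinf (a * q / z * q ^ j) q"
      by (rule qpinf_split[OF q])+
    have s2: "qpinf (x * q ^ j) q = qpoch (x * q ^ j) q j * qpinf (x * q ^ (2 * j)) q" for x
      using qpinf_split[OF q, of "x * q ^ j" j] unfolding q2 by (simp only: mult.assoc)
    have nz: "qpinf (k * q * q ^ (2 * j)) q \<noteq> 0" "qpinf (a * q * q ^ (2 * j)) q \<noteq> 0"
      "qpinf (k * q / z * q ^ j) q \<noteq> 0" "qpinf (a * q / z * q ^ j) q \<noteq> 0"
      using kq[of "2 * j + _"] a1[of "2 * j + _"] kz[of "j + _"] az[of "j + _"]
      unfolding qpinf_eq_0_iff[OF q] by (simp_all add: power_add mult_ac z0)
    have nz': "qpoch (k * q) q n \<noteq> 0" "qpoch (a * q) q n \<noteq> 0" "qpoch (k * q / z) q n \<noteq> 0"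
      "qpoch (a * q / z) q n \<noteq> 0" for n
      unfolding qpoch_eq_0_iff using kq a1 kz az by auto
    have nz'': "qpoch (k * q * q ^ j) q j \<noteq> 0" "qpoch (a * q * q ^ j) q j \<noteq> 0"
      using nz'(1)[of "j + j"] nz'(2)[of "j + j"] unfolding qpoch_add by auto
    have k2: "1 - k \<noteq> 0" using k1[of 0] by simp
    \<comment> \<open>Both sides are (k;q)_{2j+1}; this absorbs the very-well-poised factor 1 -
      K.\<close>
    have split: "(1 - k) * qpoch (k * q) q (2 * j) = qpoch k q (2 * j) * (1 - K)"
      unfolding qpoch_Suc_left[symmetric] qpoch_Suc K_def ..
    have "qpoch k q (2 * j) * (1 - K) / (1 - k) = qpoch (k * q) q (2 * j)"
      unfolding split[symmetric] using k2 by simp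
    hence k2j: "qpoch k q (2 * j) * (1 - K) / (1 - k) = qpoch (k * q) q j * qpoch (k * q * q ^ j) q j"
      by (simp only: mult_2 qpoch_add)
    have a2j: "qpoch (a * q) q (2 * j) = qpoch (a * q) q j * qpoch (a * q * q ^ j) q j"
      by (simp add: mult_2 qpoch_add)
    have P: "P = qpoch (k * q / z) q j * qpoch (a * q * q ^ j) q j /
        (qpoch (a * q / z) q j * qpoch (k * q * q ^ j) q j)"
      unfolding P_def s1 s2[of "k * q"] s2[of "a * q"] using nz nz' nz'' by (simp add: field_simps)
    have "X = (qpoch k q (2 * j) * (1 - K) / (1 - k)) * qpoch z q j * qpoch q q (j - 1) /
        (qpoch (k * q) q j * qpoch (k * q / z) q j * qpoch (a * q) q (2 * j)) * (a * q / z) ^ j"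
      unfolding X_def wp_beta_coeff_def wp_kernel_def K_def[symmetric]
      unfolding mult_2 by (simp add: mult_ac)
    also have "\<dots> = qpoch (k * q * q ^ j) q j * qpoch z q j * qpoch q q (j - 1) /
        (qpoch (k * q / z) q j * qpoch (a * q) q j * qpoch (a * q * q ^ j) q j) * (a * q / z) ^ j"
      unfolding k2j a2j using nz' by (simp add: mult.assoc)
    finally show ?thesis
      unfolding P wp_alpha_coeff_def using nz' nz'' by simp
  qed
  with sums_mult[OF tP, of X] show ?thesis by (simp add: term_eq)
qed

text \<open>This reduces absolute convergence of the double series to that of the alpha-series. The
  product (z;q)_n is split at j rather than divided by (z;q)_j, which may vanish.\<close>

lemma wp_coeff_bound:
  "\<exists>C\<ge>0. \<forall>n j. j \<le> n \<longrightarrow>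
     norm (wp_beta_coeff n * wp_kernel n j) \<le> C * norm (wp_alpha_coeff j) * norm (a * q / z) ^ (n - j)"
proof -
  define w where "w = a * q / z"
  obtain Mz where Mz: "Mz > 0" "\<And>n m. norm (qpoch (z * q ^ m) q n) \<le> Mz"
    using qpoch_bounded[OF q, of z] by metis
  obtain Mq where Mq: "Mq > 0" "\<And>n m. norm (qpoch (q * q ^ m) q n) \<le> Mq"
    using qpoch_bounded[OF q, of q] by metis
  obtain Ma where Ma: "Ma > 0" "\<And>n m. norm (qpoch (a * q * q ^ m) q n) \<le> Ma"
    using qpoch_bounded[OF q, of "a * q"] by metis
  obtain Mw where Mw: "Mw > 0" "\<And>n m. norm (qpoch (w * q ^ m) q n) \<le> Mw"
    using qpoch_bounded[OF q, of w] by metis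
  obtain Mb where Mb: "Mb > 0" "\<And>n m. norm (qpoch (k / a * q ^ m) q n) \<le> Mb"
    using qpoch_bounded[OF q, of "k / a"] by metis
  obtain Mk where Mk: "Mk > 0" "\<And>n m. norm (qpoch (k * q ^ m) q n) \<le> Mk"
    using qpoch_bounded[OF q, of k] by metis
  have kq: "k * q * q ^ i \<noteq> 1" for i using k1[of "Suc i"] by (simp add: mult_ac)
  obtain Lq where Lq: "Lq > 0" "\<And>n m. norm (qpoch (q * q ^ m) q n) \<ge> Lq"
    using qpoch_bounded_below[OF q power_Suc_neq_1[OF q]] by metis
  obtain Lk where Lk: "Lk > 0" "\<And>n m. norm (qpoch (k * q * q ^ m) q n) \<ge> Lk"
    using qpoch_bounded_below[OF q kq] by metis
  obtain Lz where Lz: "Lz > 0" "\<And>n m. norm (qpoch (k * q / z * q ^ m) q n) \<ge> Lz"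
    using qpoch_bounded_below[OF q kz] by metis
  obtain La where La: "La > 0" "\<And>n m. norm (qpoch (a * q * q ^ m) q n) \<ge> La"
    using qpoch_bounded_below[OF q a1] by metis
  define C where "C = (1 + norm k) / norm (1 - k) * Mz * Mq * Ma * Mw * Mb * Mk / (Lq * Lk * Lz * Lq * La)"
  have C0: "C \<ge> 0"
    unfolding C_def using Mz Mq Ma Mw Mb Mk Lq Lk Lz La by (auto intro!: divide_nonneg_nonneg mult_nonneg_nonneg)
  have "norm (wp_beta_coeff n * wp_kernel n j) \<le> C * norm (wp_alpha_coeff j) * norm w ^ (n - j)"
    if j: "j \<le> n" for n j
  proof -
    have nz: "qpoch q q (j - 1) \<noteq> 0" "qpoch (a * q) q j \<noteq> 0" "qpoch w q j \<noteq> 0"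
      unfolding qpoch_eq_0_iff w_def using power_Suc_neq_1[OF q] a1 az by blast+
    have k2: "norm (1 - k * q ^ (2 * n)) \<le> 1 + norm k"
    proof -
      have "norm (k * q ^ (2 * n)) \<le> norm k * 1"
        unfolding norm_mult norm_power using q by (intro mult_left_mono power_le_one) auto
      thus ?thesis using norm_triangle_ineq4[of 1 "k * q ^ (2 * n)"] by simp
    qed
    have k3: "norm (1 - k) > 0" using k1[of 0] by simp
    have "qpoch z q n = qpoch z q j * qpoch (z * q ^ j) q (n - j)"
      using qpoch_add[of z q j "n - j"] j by simp
    moreover have "w ^ n = w ^ j * w ^ (n - j)" using j by (simp add: power_add[symmetric])
    ultimately have "wp_beta_coeff n * wp_kernel n j = wp_alpha_coeff j * w ^ (n - j) *
       ((1 - k * q ^ (2 * n)) / (1 - k) * qpoch (z * q ^ j) q (n - j) * qpoch q q (n - 1) * qpoch (a * q) q j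
         * qpoch w q j * qpoch (k / a) q (n - j) * qpoch k q (n + j) /
         (qpoch q q (j - 1) * qpoch (k * q) q n * qpoch (k * q / z) q n * qpoch q q (n - j) * qpoch (a * q) q (n + j)))"
      unfolding wp_beta_coeff_def wp_alpha_coeff_def wp_kernel_def w_def[symmetric]
      using nz by (simp add: mult_ac)
    hence "norm (wp_beta_coeff n * wp_kernel n j) = norm (wp_alpha_coeff j) * norm w ^ (n - j) *
       (norm (1 - k * q ^ (2 * n)) / norm (1 - k) * norm (qpoch (z * q ^ j) q (n - j)) * norm (qpoch q q (n - 1))
         * norm (qpoch (a * q) q j)
         * norm (qpoch w q j) * norm (qpoch (k / a) q (n - j)) * norm (qpoch k q (n + j)) /
         (norm (qpoch q q (j - 1)) * norm (qpoch (k * q) q n) * norm (qpoch (k * q / z) q n)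
          * norm (qpoch q q (n - j)) * norm (qpoch (a * q) q (n + j))))"
      by (simp only: norm_mult norm_divide norm_power)
    also have "\<dots> \<le> norm (wp_alpha_coeff j) * norm w ^ (n - j) * C"
      unfolding C_def
      by (intro mult_left_mono frac_le mult_mono mult_nonneg_nonneg mult_pos_pos divide_nonneg_nonneg)
         (use k2 k3 Mz Mq(1) Mq(2)[of 0] Ma(1) Ma(2)[of 0] Mw(1) Mw(2)[of 0] Mb(1) Mb(2)[of 0] Mk(1) Mk(2)[of 0]
            Lq(1) Lq(2)[of 0] Lk(1) Lk(2)[of 0] Lz(1) Lz(2)[of 0] La(1) La(2)[of 0] in \<open>auto simp: less_imp_le\<close>)
    finally show ?thesis by (simp add: mult_ac)
  qed
  thus ?thesis unfolding w_def using C0 by blast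
qed

theorem wp_bailey_sum:
  assumes wp: "wp_bailey_pair a k q \<alpha> \<beta>"
    and summable_alpha: "summable (\<lambda>n. norm (wp_alpha_coeff n * \<alpha> n))"
  shows "(\<lambda>n. wp_beta_coeff (Suc n) * \<beta> (Suc n)) sums
     (lambert q k + lambert q (a / z) - lambert q a - lambert q (k / z)
       + (\<Sum>n. wp_alpha_coeff (Suc n) * \<alpha> (Suc n)))"
proof -
  \<comment> \<open>The condition \<open>0 < n\<close> removes the corner (0, 0): the beta-series
    starts at n = 1, whereas \<open>wp_beta_coeff 0\<close> is 1.\<close>
  define F where "F = (\<lambda>j n. if j \<le> n \<and> 0 < n then wp_beta_coeff n * wp_kernel n j * \<alpha> j else 0)"
  define r where "r = norm (a * q / z)"
  have r: "r \<ge> 0" "r < 1" using w1 by (simp_all add: r_def)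
  obtain C where C: "C \<ge> 0" "\<And>n j. j \<le> n \<Longrightarrow>
      norm (wp_beta_coeff n * wp_kernel n j) \<le> C * norm (wp_alpha_coeff j) * r ^ (n - j)"
    using wp_coeff_bound unfolding r_def by blast
  have geom: "(\<lambda>n. if j \<le> n then r ^ (n - j) else 0) sums (1 / (1 - r))" for j
  proof -
    have "(\<lambda>i. r ^ i) sums (1 / (1 - r))" using r by (intro geometric_sums) auto
    hence "(\<lambda>n. (if j \<le> n + j then r ^ (n + j - j) else 0)) sums (1 / (1 - r))" by simp
    moreover have "(\<Sum>i<j. if j \<le> i then r ^ (i - j) else 0) = 0" by (intro sum.neutral) auto
    ultimately show ?thesis
      using sums_iff_shift[of "\<lambda>n. if j \<le> n then r ^ (n - j) else 0" j "1 / (1 - r)"] by simp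
  qed
  have F_le:
    "norm (F j n) \<le> C * norm (wp_alpha_coeff j * \<alpha> j) * (if j \<le> n then r ^ (n - j) else 0)" for j n
  proof (cases "j \<le> n \<and> 0 < n")
    case True
    hence "norm (F j n) \<le> C * norm (wp_alpha_coeff j) * r ^ (n - j) * norm (\<alpha> j)"
      unfolding F_def using C(2)[of j n] by (simp add: norm_mult[of _ "\<alpha> j"] mult_right_mono)
    thus ?thesis using True by (simp add: norm_mult mult_ac)
  next
    case False
    hence "F j n = 0" by (auto simp: F_def)
    thus ?thesis using C(1) r by simp
  qed
  have geom': "(\<lambda>n. C * norm (wp_alpha_coeff j * \<alpha> j) * (if j \<le> n then r ^ (n - j) else 0)) sums
      (C * norm (wp_alpha_coeff j * \<alpha> j) * (1 / (1 - r)))" for j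
    by (intro sums_mult geom)
  have rows: "summable (\<lambda>n. norm (F j n))" for j
    by (rule summable_comparison_test'[OF sums_summable[OF geom'[of j]], where N = 0])
       (simp only: real_norm_def abs_norm_cancel F_le)
  have row_le: "(\<Sum>n. norm (F j n)) \<le> C * norm (wp_alpha_coeff j * \<alpha> j) * (1 / (1 - r))" for j
    using suminf_le[OF F_le rows sums_summable[OF geom']] sums_unique[OF geom'] by metis
  have total: "summable (\<lambda>j. \<Sum>n. norm (F j n))"
  proof (rule summable_comparison_test'[where N = 0])
    show "summable (\<lambda>j. C * norm (wp_alpha_coeff j * \<alpha> j) * (1 / (1 - r)))"
      by (intro summable_mult summable_mult2 summable_alpha)
    show "norm (\<Sum>n. norm (F j n)) \<le> C * norm (wp_alpha_coeff j * \<alpha> j) * (1 / (1 - r))" for j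
      using row_le[of j] suminf_nonneg[OF rows[of j]] by simp
  qed
  have "(\<lambda>n. \<Sum>j\<le>n. F j n) sums (\<Sum>j. \<Sum>n. F j n)"
    by (rule sums_lower_triangle[OF _ rows total]) (simp add: F_def)
  moreover have "(\<Sum>j\<le>Suc n. F j (Suc n)) = wp_beta_coeff (Suc n) * \<beta> (Suc n)" for n
  proof -
    have "\<beta> (Suc n) = (\<Sum>j\<le>Suc n. wp_kernel (Suc n) j * \<alpha> j)"
      using wp unfolding wp_bailey_pair_def wp_kernel_def by blast
    thus ?thesis by (simp add: F_def sum_distrib_left mult_ac del: sum.atMost_Suc)
  qed
  moreover have "(\<Sum>j\<le>0. F j 0) = 0" by (simp add: F_def)
  ultimately have main: "(\<lambda>n. wp_beta_coeff (Suc n) * \<beta> (Suc n)) sums (\<Sum>j. \<Sum>n. F j n)"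
    using sums_Suc_iff[of "\<lambda>n. \<Sum>j\<le>n. F j n" "\<Sum>j. \<Sum>n. F j n"] by simp
  have \<alpha>0: "\<alpha> 0 = 1" using wp by (simp add: wp_bailey_pair_def)
  have row0: "(\<Sum>n. F 0 n) = lambert q k + lambert q (a / z) - lambert q a - lambert q (k / z)"
  proof -
    have "(\<lambda>n. F 0 (Suc n)) sums (lambert q k + lambert q (a / z) - lambert q a - lambert q (k / z))"
      using column_0_sums by (simp add: F_def \<alpha>0)
    hence "(\<lambda>n. F 0 n) sums (lambert q k + lambert q (a / z) - lambert q a - lambert q (k / z) + F 0 0)"
      by (simp only: sums_Suc_iff[symmetric] diff_add_cancel add_diff_cancel_right')
    thus ?thesis by (simp add: F_def sums_iff)
  qed
  have row_Suc: "(\<Sum>n. F (Suc j) n) = wp_alpha_coeff (Suc j) * \<alpha> (Suc j)" for j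
  proof -
    have "(\<lambda>m. F (Suc j) (m + Suc j)) sums (wp_alpha_coeff (Suc j) * \<alpha> (Suc j))"
      using sums_mult2[OF column_sums[of "Suc j"], of "\<alpha> (Suc j)"] by (simp add: F_def add.commute)
    moreover have "(\<Sum>i<Suc j. F (Suc j) i) = 0" by (intro sum.neutral) (auto simp: F_def)
    ultimately have "F (Suc j) sums (wp_alpha_coeff (Suc j) * \<alpha> (Suc j))"
      using sums_iff_shift[of "F (Suc j)" "Suc j"] by simp
    thus ?thesis by (simp add: sums_iff)
  qed
  have "summable (\<lambda>j. \<Sum>n. F j n)"
    by (rule summable_comparison_test'[OF total, where N = 0]) (use summable_norm[OF rows] in simp)
  from suminf_split_head[OF this] have "(\<Sum>j. \<Sum>n. F j n) =
      lambert q k + lambert q (a / z) - lambert q a - lambert q (k / z)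
       + (\<Sum>n. wp_alpha_coeff (Suc n) * \<alpha> (Suc n))"
    by (simp add: row0 row_Suc algebra_simps)
  with main show ?thesis by simp
qed

end

section \<open>Square roots, the theta form of the Lambert terms, and the final assembly\<close>

lemma qpoch_sqrt_ratio:
  assumes "qpoch s q n \<noteq> 0" "qpoch (- s) q n \<noteq> 0" "s ^ 2 \<noteq> 1"
  shows "qpoch (q * s) q n * qpoch (- q * s) q n / (qpoch s q n * qpoch (- s) q n) =
    (1 - s ^ 2 * q ^ (2 * n)) / (1 - s ^ 2)"
proof -
  have *: "(1 - x) * qpoch (q * x) q n = qpoch x q n * (1 - x * q ^ n)" for x
    using qpoch_Suc_left[of x q n] by (simp add: qpoch_Suc mult.commute)
  have q2: "q ^ (2 * n) = q ^ n * q ^ n" by (simp add: mult_2 power_add)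
  have "(1 - s ^ 2) * (qpoch (q * s) q n * qpoch (- q * s) q n) =
      ((1 - s) * qpoch (q * s) q n) * ((1 - (- s)) * qpoch (q * (- s)) q n)"
    by (simp add: algebra_simps power2_eq_square)
  also have "\<dots> = (1 - s ^ 2 * q ^ (2 * n)) * (qpoch s q n * qpoch (- s) q n)"
    unfolding * q2 by (simp add: algebra_simps power2_eq_square)
  finally show ?thesis
    using assms by (subst frac_eq_eq) (simp_all add: mult_ac)
qed

lemma qpinf_0_right: "qpinf x 0 = 1 - x"
proof -
  have "qpinf 0 0 = 1" by (simp add: qpinf_def)
  thus ?thesis using qpinf_Suc[of 0 x] by simp
qed

text \<open>An arbitrary square root is allowed because for the inverted parameters the root is
  \<open>1 / csqrt k\<close> rather than the principal root of 1/k.\<close>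

lemma (in wp_bailey_sum) wp_beta_coeff_sqrt:
  assumes "s ^ 2 = k" and "qpoch s q n * qpoch (- s) q n \<noteq> 0"
  shows "qpoch (q * s) q n * qpoch (- q * s) q n * qpoch z q n * qpoch q q (n - 1)
      / (qpoch s q n * qpoch (- s) q n * qpoch (q * k) q n * qpoch (q * k / z) q n) * (q * a / z) ^ n
    = wp_beta_coeff n"
proof -
  have "s ^ 2 \<noteq> 1" using k1[of 0] assms(1) by simp
  hence ratio: "qpoch (q * s) q n * qpoch (- q * s) q n / (qpoch s q n * qpoch (- s) q n) =
      (1 - k * q ^ (2 * n)) / (1 - k)"
    using qpoch_sqrt_ratio[of s q n] assms by simp
  show ?thesis
    unfolding wp_beta_coeff_def ratio[symmetric] by (simp add: mult_ac)
qed

lemma lambert_theta_identity: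
  fixes q a k z :: complex
  assumes q: "norm q < 1" and q0: "q \<noteq> 0" and a: "a \<noteq> 0" and k: "k \<noteq> 0" and z: "z \<noteq> 0"
    and ta: "qtheta q a \<noteq> 0" and tk: "qtheta q k \<noteq> 0"
    and tza: "qtheta q (z / a) \<noteq> 0" and tzk: "qtheta q (z / k) \<noteq> 0"
  shows "(lambert q k + lambert q (a / z) - lambert q a - lambert q (k / z))
     - (lambert q (1 / k) + lambert q (z / a) - lambert q (1 / a) - lambert q (z / k)) =
     (a - k) * (1 - 1 / z) * (1 - a * k / z) / ((1 - a) * (1 - k) * (1 - a / z) * (1 - k / z))
     + z / k * (qtheta q z * qtheta q (k / a) * qtheta q (a * k / z) * qpinf q q ^ 2 /
         (qtheta q (z / k) * qtheta q (z / a) * qtheta q a * qtheta q k))"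
proof -
  \<comment> \<open>The product in the theorem contains z/a and z/k instead of their inverses; the
    two inversions turn the prefactor a/z into z/k.\<close>
  have taz: "qtheta q (a / z) = - qtheta q (z / a) * a / z"
    using qtheta_inverse[OF q q0, of "z / a"] a z by simp
  have tkz: "qtheta q (k / z) = - qtheta q (z / k) * k / z"
    using qtheta_inverse[OF q q0, of "z / k"] k z by simp
  have nz: "qtheta q (a / z) \<noteq> 0" "qtheta q (k / z) \<noteq> 0"
    unfolding taz tkz using a k z tza tzk by simp_all
  have E: "qzeta q x = x / (1 - x) + lambert q x - lambert q (1 / x)"
    if "x \<noteq> 0" "qtheta q x \<noteq> 0" for x
    using that by (rule qzeta_eq_lambert[OF q q0])
  have ne1: "1 - x \<noteq> 0" if "qtheta q x \<noteq> 0" for x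
    using that qtheta_1[OF q q0] by auto
  have "(lambert q k + lambert q (a / z) - lambert q a - lambert q (k / z))
     - (lambert q (1 / k) + lambert q (z / a) - lambert q (1 / a) - lambert q (z / k)) =
     (a / (1 - a) - k / (1 - k) + (k / z) / (1 - k / z) - (a / z) / (1 - a / z))
     + (qzeta q k - qzeta q (k / z) + qzeta q (a / z) - qzeta q a)"
    using E[OF k tk] E[OF _ nz(1)] E[OF a ta] E[OF _ nz(2)] a k z by simp
  also have "a / (1 - a) - k / (1 - k) = (a - k) / ((1 - a) * (1 - k))"
    using ne1[OF ta] ne1[OF tk] by (simp add: diff_frac_eq algebra_simps)
  also have "(a - k) / ((1 - a) * (1 - k)) + (k / z) / (1 - k / z) - (a / z) / (1 - a / z) =
      (a - k) / ((1 - a) * (1 - k)) - (a - k) / z / ((1 - a / z) * (1 - k / z))"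
  proof -
    have "(k / z) / (1 - k / z) - (a / z) / (1 - a / z) =
        ((k / z) * (1 - a / z) - (a / z) * (1 - k / z)) / ((1 - k / z) * (1 - a / z))"
      by (rule diff_frac_eq[OF ne1[OF nz(2)] ne1[OF nz(1)]])
    also have "(k / z) * (1 - a / z) - (a / z) * (1 - k / z) = - ((a - k) / z)"
      by (simp add: algebra_simps diff_divide_distrib)
    finally show ?thesis by (simp add: mult_ac)
  qed
  also have "\<dots> = (a - k) * ((1 - a / z) * (1 - k / z) - (1 - a) * (1 - k) / z)
      / (((1 - a) * (1 - k)) * ((1 - a / z) * (1 - k / z)))"
  proof -
    have "(a - k) / P - (a - k) / z / Q = (a - k) * (Q - P / z) / (P * Q)"
      if "P \<noteq> 0" "Q \<noteq> 0" for P Q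
      using that z by (simp add: field_simps)
    note combine = this
    show ?thesis
      by (rule combine[OF no_zero_divisors[OF ne1[OF ta] ne1[OF tk]]
            no_zero_divisors[OF ne1[OF nz(1)] ne1[OF nz(2)]]])
  qed
  also have "(1 - a / z) * (1 - k / z) - (1 - a) * (1 - k) / z = (1 - 1 / z) * (1 - a * k / z)"
    using z by (simp add: field_simps power2_eq_square)
  also have "qzeta q k - qzeta q (k / z) + qzeta q (a / z) - qzeta q a =
      z / k * (qtheta q z * qtheta q (k / a) * qtheta q (a * k / z) * qpinf q q ^ 2 /
         (qtheta q (z / k) * qtheta q (z / a) * qtheta q a * qtheta q k))"
    unfolding qzeta_four_term[OF q q0 a k z ta tk nz] deriv_qtheta_1[OF q q0] taz tkz
    using a k z by (simp add: field_simps)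
  finally show ?thesis by (simp add: mult_ac)
qed

theorem theorem1p1:
  fixes q a k z :: complex
    and \<alpha> \<beta> :: "complex \<Rightarrow> complex \<Rightarrow> nat \<Rightarrow> complex"
  defines "T1 \<equiv> \<lambda>n. qpoch (q * csqrt k) q n * qpoch (- q * csqrt k) q n * qpoch z q n
                      * qpoch q q (n - 1)
                   / (qpoch (csqrt k) q n * qpoch (- csqrt k) q n * qpoch (q * k) q n
                      * qpoch (q * k / z) q n) * (q * a / z) ^ n * \<beta> a k n"
    and "T2 \<equiv> \<lambda>n. qpoch (q / csqrt k) q n * qpoch (- q / csqrt k) q n * qpoch (1 / z) q n
                      * qpoch q q (n - 1)
                   / (qpoch (1 / csqrt k) q n * qpoch (- 1 / csqrt k) q n * qpoch (q / k) q n
                      * qpoch (q * z / k) q n) * (q * z / a) ^ n * \<beta> (1 / a) (1 / k) n"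
    and "T3 \<equiv> \<lambda>n. qpoch z q n * qpoch q q (n - 1)
                   / (qpoch (q * a) q n * qpoch (q * a / z) q n) * (q * a / z) ^ n * \<alpha> a k n"
    and "T4 \<equiv> \<lambda>n. qpoch (1 / z) q n * qpoch q q (n - 1)
                   / (qpoch (q / a) q n * qpoch (q * z / a) q n) * (q * z / a) ^ n
                   * \<alpha> (1 / a) (1 / k) n"
  assumes hq: "norm q < 1"
    and hWP1: "wp_bailey_pair a k q (\<alpha> a k) (\<beta> a k)"
    and hWP2: "wp_bailey_pair (1 / a) (1 / k) q (\<alpha> (1 / a) (1 / k)) (\<beta> (1 / a) (1 / k))"
    and hz1: "norm (q * a) < norm z"
    and hz2: "norm z * norm q < norm a"
    and ha: "a \<noteq> 0" and hk: "k \<noteq> 0"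
    and hden1: "\<forall>n. qpoch (csqrt k) q n * qpoch (- csqrt k) q n * qpoch (q * k) q n
                      * qpoch (q * k / z) q n \<noteq> 0"
    and hden2: "\<forall>n. qpoch (1 / csqrt k) q n * qpoch (- 1 / csqrt k) q n * qpoch (q / k) q n
                      * qpoch (q * z / k) q n \<noteq> 0"
    and hden3: "\<forall>n. qpoch (q * a) q n * qpoch (q * a / z) q n \<noteq> 0"
    and hden4: "\<forall>n. qpoch (q / a) q n * qpoch (q * z / a) q n \<noteq> 0"
    and hden5: "(1 - a) * (1 - k) * (1 - a / z) * (1 - k / z) \<noteq> 0"
    and hden6: "qpinf (z / k) q * qpinf (q * k / z) q * qpinf (z / a) q * qpinf (q * a / z) q
                * qpinf a q * qpinf (q / a) q * qpinf k q * qpinf (q / k) q \<noteq> 0"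
    and hconv1: "summable (\<lambda>n. norm (T1 (Suc n)))"
    and hconv2: "summable (\<lambda>n. norm (T2 (Suc n)))"
    and hconv3: "summable (\<lambda>n. norm (T3 (Suc n)))"
    and hconv4: "summable (\<lambda>n. norm (T4 (Suc n)))"
  shows "(\<Sum>n. T1 (Suc n)) - (\<Sum>n. T2 (Suc n)) - (\<Sum>n. T3 (Suc n)) + (\<Sum>n. T4 (Suc n))
       = (a - k) * (1 - 1 / z) * (1 - a * k / z)
           / ((1 - a) * (1 - k) * (1 - a / z) * (1 - k / z))
         + z / k * (qpinf z q * qpinf (q / z) q * qpinf (k / a) q * qpinf (q * a / k) q
                    * qpinf (a * k / z) q * qpinf (q * z / (a * k)) q * qpinf q q * qpinf q q)
                 / (qpinf (z / k) q * qpinf (q * k / z) q * qpinf (z / a) q * qpinf (q * a / z) q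
                    * qpinf a q * qpinf (q / a) q * qpinf k q * qpinf (q / k) q)"
proof (cases "q = 0")
  \<comment> \<open>Theta has no shift equation for q = 0. Here all terms of the four series vanish,
    every infinite product is its first factor, and the two summands on the right cancel.\<close>
  case True
  have z: "z \<noteq> 0" using hz1 by auto
  have T0: "T1 (Suc n) = 0" "T2 (Suc n) = 0" "T3 (Suc n) = 0" "T4 (Suc n) = 0" for n
    unfolding T1_def T2_def T3_def T4_def True by simp_all
  have nz: "1 - z / k \<noteq> 0" "1 - z / a \<noteq> 0" "1 - a \<noteq> 0" "1 - k \<noteq> 0" "1 - a / z \<noteq> 0" "1 - k / z \<noteq> 0"
    using hden5 hden6 unfolding True qpinf_0_right by auto
  have factors: "1 - z / k = - (z / k) * (1 - k / z)" "1 - z / a = - (z / a) * (1 - a / z)"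
    "1 - z = - z * (1 - 1 / z)" "1 - k / a = (a - k) / a"
    using z ha hk by (simp_all add: field_simps)
  have cancel: "(a - k) * U * V / (A * K * Y * X) +
      z / k * ((- z * U) * ((a - k) / a) * V) / ((- (z / k) * X) * (- (z / a) * Y) * A * K) = 0"
    if "A \<noteq> 0" "K \<noteq> 0" "X \<noteq> 0" "Y \<noteq> 0" for A K X Y U V
    using that z ha hk by (simp add: field_simps)
  have "(a - k) * (1 - 1 / z) * (1 - a * k / z) / ((1 - a) * (1 - k) * (1 - a / z) * (1 - k / z)) +
      z / k * ((1 - z) * (1 - k / a) * (1 - a * k / z)) / ((1 - z / k) * (1 - z / a) * (1 - a) * (1 - k)) = 0"
    unfolding factors by (rule cancel) (use nz in blast)+
  thus ?thesis
    unfolding T0 unfolding True qpinf_0_right by simp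
next
  case False
  note q0 = False
  have z: "z \<noteq> 0" using hz1 by auto
  have inf_nz: "qpinf (z / k) q \<noteq> 0" "qpinf (q * k / z) q \<noteq> 0" "qpinf (z / a) q \<noteq> 0" "qpinf (q * a / z) q \<noteq> 0"
    "qpinf a q \<noteq> 0" "qpinf (q / a) q \<noteq> 0" "qpinf k q \<noteq> 0" "qpinf (q / k) q \<noteq> 0"
    using hden6 by auto
  have pw: "x * q ^ j \<noteq> 1" if "qpinf x q \<noteq> 0" for x j
    using that by (simp add: qpinf_eq_0_iff[OF hq])
  interpret s1: wp_bailey_sum q a k z
  proof
    show "k * q ^ j \<noteq> 1" for j using pw[OF inf_nz(7)] .
    show "a * q * q ^ j \<noteq> 1" for j using pw[OF inf_nz(5), of "Suc j"] by (simp add: mult_ac)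
    show "k * q / z * q ^ j \<noteq> 1" for j using pw[OF inf_nz(2), of j] by (simp add: mult_ac)
    show "norm (a * q / z) < 1" using hz1 z by (simp add: norm_mult norm_divide mult_ac)
  qed (use hq q0 ha hk z in auto)
  interpret s2: wp_bailey_sum q "1 / a" "1 / k" "1 / z"
  proof
    \<comment> \<open>The product (q/k;q)_infinity covers only j >= 1; the case j = 0 is k != 1,
      taken from \<open>hden5\<close>.\<close>
    show "1 / k * q ^ j \<noteq> 1" for j
    proof (cases j)
      case 0
      thus ?thesis using hden5 hk by auto
    next
      case (Suc i)
      thus ?thesis using pw[OF inf_nz(8), of i] by simp
    qed
    show "1 / a * q * q ^ j \<noteq> 1" for j using pw[OF inf_nz(6), of j] by simp
    show "1 / k * q / (1 / z) * q ^ j \<noteq> 1" for j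
      using pw[OF inf_nz(1), of "Suc j"] by (simp add: mult_ac)
    show "norm (1 / a * q / (1 / z)) < 1" using hz2 ha by (simp add: norm_mult norm_divide mult_ac)
  qed (use hq q0 ha hk z in auto)
  have T1: "T1 n = s1.wp_beta_coeff n * \<beta> a k n" for n
    unfolding T1_def using hden1 by (subst s1.wp_beta_coeff_sqrt) auto
  have T2: "T2 n = s2.wp_beta_coeff n * \<beta> (1 / a) (1 / k) n" for n
  proof -
    have "(1 / csqrt k) ^ 2 = 1 / k" by (simp add: power_divide)
    moreover have "qpoch (1 / csqrt k) q n * qpoch (- (1 / csqrt k)) q n \<noteq> 0"
      using hden2 by auto
    ultimately show ?thesis
      unfolding T2_def using s2.wp_beta_coeff_sqrt[of "1 / csqrt k" n] by simp
  qed
  have T3: "T3 n = s1.wp_alpha_coeff n * \<alpha> a k n" for n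
    unfolding T3_def s1.wp_alpha_coeff_def by (simp add: mult_ac)
  have T4: "T4 n = s2.wp_alpha_coeff n * \<alpha> (1 / a) (1 / k) n" for n
    unfolding T4_def s2.wp_alpha_coeff_def by (simp add: mult_ac)
  have "summable (\<lambda>n. norm (s1.wp_alpha_coeff n * \<alpha> a k n))"
    using hconv3 unfolding T3
    by (simp only: summable_Suc_iff[of "\<lambda>n. norm (s1.wp_alpha_coeff n * \<alpha> a k n)"])
  from s1.wp_bailey_sum[OF hWP1 this]
  have 1: "(\<Sum>n. T1 (Suc n)) = lambert q k + lambert q (a / z) - lambert q a - lambert q (k / z)
      + (\<Sum>n. T3 (Suc n))"
    unfolding T1 T3 by (simp add: sums_iff)
  have "summable (\<lambda>n. norm (s2.wp_alpha_coeff n * \<alpha> (1 / a) (1 / k) n))"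
    using hconv4 unfolding T4
    by (simp only: summable_Suc_iff[of "\<lambda>n. norm (s2.wp_alpha_coeff n * \<alpha> (1 / a) (1 / k) n)"])
  from s2.wp_bailey_sum[OF hWP2 this]
  have 2: "(\<Sum>n. T2 (Suc n)) =
      lambert q (1 / k) + lambert q (z / a) - lambert q (1 / a) - lambert q (z / k)
      + (\<Sum>n. T4 (Suc n))"
    unfolding T2 T4 by (simp add: sums_iff)
  have theta: "qtheta q z = qpinf z q * qpinf (q / z) q" "qtheta q a = qpinf a q * qpinf (q / a) q"
    "qtheta q k = qpinf k q * qpinf (q / k) q" "qtheta q (k / a) = qpinf (k / a) q * qpinf (q * a / k) q"
    "qtheta q (a * k / z) = qpinf (a * k / z) q * qpinf (q * z / (a * k)) q"
    "qtheta q (z / k) = qpinf (z / k) q * qpinf (q * k / z) q"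
    "qtheta q (z / a) = qpinf (z / a) q * qpinf (q * a / z) q"
    by (simp_all add: qtheta_def)
  have "(\<Sum>n. T1 (Suc n)) - (\<Sum>n. T2 (Suc n)) - (\<Sum>n. T3 (Suc n)) + (\<Sum>n. T4 (Suc n)) =
      (lambert q k + lambert q (a / z) - lambert q a - lambert q (k / z))
       - (lambert q (1 / k) + lambert q (z / a) - lambert q (1 / a) - lambert q (z / k))"
    unfolding 1 2 by simp
  also note lambert_theta_identity[OF hq q0 ha hk z]
  finally show ?thesis
    using inf_nz unfolding theta by (simp add: power2_eq_square mult_ac)
qed

end
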